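(* Let $m\in\mathbb{N}$ and $A\subseteq\mathbb{N}^m$. The following two statements are equivalent. (1) There exist functions $\alpha_1,\ldots,\alpha_m:\mathcal{P}_f(\mathbb{N}^{\mathbb{N}})\to\mathbb{N}$ and $H_1,\ldots,H_m:\mathcal{P}_f(\mathbb{N}^{\mathbb{N}})\to\mathcal{P}_f(\mathbb{N})$ such that (a) if $F,G\in\mathcal{P}_f(\mathbb{N}^{\mathbb{N}})$ and $F\subsetneq G$, then for every $i\in\{1,\ldots,m\}$, $\max H_i(F)<\min H_i(G)$; and (b) whenever $(G_i)_{i\in\mathbb{N}}$ is a sequence in $\mathcal{P}_f(\mathbb{N}^{\mathbb{N}})$ with $G_1\subsetneq G_2\subsetneq\cdots\subsetneq G_n\subsetneq\cdots$, then for all $\beta_1<\cdots<\beta_m$ in $\mathcal{P}_f(\mathbb{N})$ and all choices of $f_i\in G_i$ ($i\in\mathbb{N}$), one has $$\left(\sum_{i\in\beta_1}\Bigl(\alpha_1(G_i)+\sum_{t\in H_1(G_i)}f_i(t)\Bigr),\ldots,\sum_{i\in\beta_m}\Bigl(\alpha_m(G_i)+\sum_{t\in H_m(G_i)}f_i(t)\Bigr)\right)\in A.$$ (2) There exist idempotents $p_1,\ldots,p_m$ in $(\mathcal{J},+)$ such that $A\in\bigotimes_{i=1}^m p_i$.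
   Context: $\mathbb{N}$ is the set of positive integers; $\mathcal{P}_f(X)$ is the set of nonempty finite subsets of $X$; $\mathbb{N}^{\mathbb{N}}$ is the set of all functions $\mathbb{N}\to\mathbb{N}$. For $\beta,\gamma\in\mathcal{P}_f(\mathbb{N})$, $\beta<\gamma$ means $\max\beta<\min\gamma$. $\beta\mathbb{N}$ is the set of ultrafilters on $\mathbb{N}$, with the operation: $A\in p+q$ iff $\{x\in\mathbb{N}:-x+A\in q\}\in p$, where $-x+A=\{y\in\mathbb{N}:x+y\in A\}$. An ultrafilter $p$ is idempotent if $p+p=p$. A set $A\subseteq\mathbb{N}$ is a $J$-set if for every $F\in\mathcal{P}_f(\mathbb{N}^{\mathbb{N}})$ there exist $a\in\mathbb{N}$ and $\beta\in\mathcal{P}_f(\mathbb{N})$ such that $a+\sum_{t\in\beta}f(t)\in A$ for all $f\in F$. $\mathcal{J}=\{p\in\beta\mathbb{N}:\text{every }A\in p\text{ is a }J\text{-set}\}$; it is a two-sided ideal of $(\beta\mathbb{N},+)$. Tensor products: for ultrafilters $p_1,\ldots,p_k$ on $\mathbb{N}$, $\bigotimes_{i=1}^k p_i$ is the ultrafilter on $\mathbb{N}^k$ defined recursively by $\bigotimes_{i=1}^1p_i=p_1$, and, for $A\subseteq\mathbb{N}^{k+1}$, $A\in\bigotimes_{i=1}^{k+1}p_i$ iff $\{(x_1,\ldots,x_k)\in\mathbb{N}^k:\{x_{k+1}\in\mathbb{N}:(x_1,\ldots,x_{k+1})\in A\}\in p_{k+1}\}\in\bigotimes_{i=1}^kp_i$.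 *)

theory Defs
  imports "HOL-Library.FuncSet"
begin

text \<open>
  The set of positive integers is the carrier \<open>pos\<close> inside \<^typ>\<open>nat\<close>. A function from \<open>pos\<close>
  to \<open>pos\<close> is an extensional one, so that it is determined by its values on \<open>pos\<close> and
  proper inclusions between sets of such functions have their usual meaning. Likewise a
  \<open>k\<close>-tuple \<open>(x\<^sub>1, \<dots>, x\<^sub>k)\<close> is an extensional function on \<open>{1..k}\<close>.
\<close>

definition pos :: "nat set" where
  "pos = {1..}"

definition pos_funs :: "(nat \<Rightarrow> nat) set" where
  "pos_funs = pos \<rightarrow>\<^sub>E pos"

definition pos_tuples :: "nat \<Rightarrow> (nat \<Rightarrow> nat) set" where
  "pos_tuples k = {1..k} \<rightarrow>\<^sub>E pos"

definition Pf :: "'a set \<Rightarrow> 'a set set" where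
  "Pf X = {F. F \<subseteq> X \<and> finite F \<and> F \<noteq> {}}"

definition block_less :: "nat set \<Rightarrow> nat set \<Rightarrow> bool" where
  "block_less \<beta> \<gamma> \<longleftrightarrow> Max \<beta> < Min \<gamma>"

definition ultrafilter_on :: "'a set \<Rightarrow> 'a set set \<Rightarrow> bool" where
  "ultrafilter_on X p \<longleftrightarrow>
     p \<subseteq> Pow X \<and> X \<in> p \<and> {} \<notin> p \<and>
     (\<forall>A B. A \<in> p \<longrightarrow> A \<subseteq> B \<longrightarrow> B \<subseteq> X \<longrightarrow> B \<in> p) \<and>
     (\<forall>A B. A \<in> p \<longrightarrow> B \<in> p \<longrightarrow> A \<inter> B \<in> p) \<and>
     (\<forall>A. A \<subseteq> X \<longrightarrow> A \<in> p \<or> X - A \<in> p)"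

definition beta_pos :: "nat set set set" where
  "beta_pos = {p. ultrafilter_on pos p}"

definition shift :: "nat \<Rightarrow> nat set \<Rightarrow> nat set" where
  "shift x A = {y \<in> pos. x + y \<in> A}"

definition uf_plus :: "nat set set \<Rightarrow> nat set set \<Rightarrow> nat set set" where
  "uf_plus p q = {A. A \<subseteq> pos \<and> {x \<in> pos. shift x A \<in> q} \<in> p}"

definition J_set :: "nat set \<Rightarrow> bool" where
  "J_set A \<longleftrightarrow> A \<subseteq> pos \<and>
     (\<forall>F \<in> Pf pos_funs. \<exists>a \<in> pos. \<exists>\<beta> \<in> Pf pos. \<forall>f \<in> F. a + (\<Sum>t\<in>\<beta>. f t) \<in> A)"

definition J_ultrafilters :: "nat set set set" where
  "J_ultrafilters = {p \<in> beta_pos. \<forall>A \<in> p. J_set A}"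

text \<open>
  \<open>tensor p k\<close> is the tensor product of \<open>p 1, \<dots>, p k\<close>, where \<open>k \<ge> 1\<close>; the value at
  \<open>k = 0\<close> is left unspecified. The base case identifies a positive integer with the
  corresponding \<open>1\<close>-tuple, and \<open>x(Suc k := y)\<close> extends a \<open>k\<close>-tuple \<open>x\<close> by \<open>y\<close>.
\<close>

fun tensor :: "(nat \<Rightarrow> nat set set) \<Rightarrow> nat \<Rightarrow> (nat \<Rightarrow> nat) set set" where
  "tensor p (Suc 0) =
     {A. A \<subseteq> pos_tuples 1 \<and> {y \<in> pos. (\<lambda>i\<in>{1}. y) \<in> A} \<in> p 1}"
| "tensor p (Suc (Suc k)) =
     {A. A \<subseteq> pos_tuples (Suc (Suc k)) \<and>
         {x \<in> pos_tuples (Suc k). {y \<in> pos. x(Suc (Suc k) := y) \<in> A} \<in> p (Suc (Suc k))}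
           \<in> tensor p (Suc k)}"

end

(*
  (1) implies (2): for each coordinate j the sums over strictly increasing chains above F form a set
  T_j(F). Each T_j(F) is a J-set, and J-sets are partition regular (Hales-Jewett), so some member of
  J contains every T_j(F). The ultrafilters in J that contain every T_j(F) form a closed
  subsemigroup, because the chains above the top of a given chain prolong it; by Ellis' theorem it
  contains an idempotent p_j. Choosing the blocks one after the other, each along a longer chain,
  shows that A is in the tensor product of the p_j.

  (2) implies (1): the values of alpha_j and H_j at F are chosen by recursion on the finite set F.
  The finitely many partial tuples of block sums that can be formed from proper subsets of F all lie
  in iterated sections of A, and idempotence, in the usual form that E in p implies
  {y : y in E and -y + E in p} in p, gives each p_j a member, hence a J-set, whose elements extend all
  of them.
*)

theory Submission
  imports Defs "HOL-Library.Countable"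
begin

section \<open>The Hales--Jewett theorem\<close>

text \<open>Topology on the space of ultrafilters is replaced by families of sets: a closed set
  consists of the ultrafilters containing a given family, compactness is the finite intersection
  property, and a smaller closed set comes from a larger family. In (1) implies (2) the obstacle is
  that the m coordinates of a tuple are sums along one common chain, whereas each p_j is found
  separately from its own \<alpha>_j and H_j. The link is that T_j(F) belongs to p_j for every F, so
  a new coordinate can start above whatever set the previous ones have reached. In (2) implies (1)
  the obstacle is that F is the top of many chains, and its values must suit all of them and every
  role that F may play in a block. This is possible because F has only finitely many subsets, so
  that the demands on coordinate j are finitely many members of p_j, and because a J-set treats all
  f in F with one constant and one block. Taking that block far to the right gives (a).\<close>

definition word_subst :: "'a \<Rightarrow> 'a option list \<Rightarrow> 'a list" where
  "word_subst x v = map (case_option x (\<lambda>y. y)) v"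

definition words :: "'a set \<Rightarrow> nat \<Rightarrow> 'a list set" where
  "words S N = {w. set w \<subseteq> S \<and> length w = N}"

text \<open>\<open>None\<close> is the variable; requiring it to occur keeps the combinatorial line
  from degenerating to a point.\<close>

definition variable_words :: "'a set \<Rightarrow> nat \<Rightarrow> 'a option list set" where
  "variable_words S N = {v. set v \<subseteq> insert None (Some ` S) \<and> None \<in> set v \<and> length v = N}"

definition constant_on_line :: "('a list \<Rightarrow> 'b) \<Rightarrow> 'a set \<Rightarrow> 'a option list \<Rightarrow> bool" where
  "constant_on_line c S v \<longleftrightarrow> (\<forall>x\<in>S. \<forall>y\<in>S. c (word_subst x v) = c (word_subst y v))"

lemma word_subst_append [simp]: "word_subst x (v @ v') = word_subst x v @ word_subst x v'"
  by (simp add: word_subst_def)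

lemma word_subst_map_Some [simp]: "word_subst x (map Some w) = w"
  by (simp add: word_subst_def comp_def)

lemma word_subst_in_words:
  assumes "v \<in> variable_words S N" "x \<in> S"
  shows "word_subst x v \<in> words S N"
proof -
  have "case_option x (\<lambda>y. y) z \<in> S" if "z \<in> set v" for z
    using assms that by (cases z) (auto simp: variable_words_def)
  then show ?thesis
    using assms by (auto simp: words_def word_subst_def variable_words_def)
qed

lemma finite_words: "finite S \<Longrightarrow> finite (words S N)"
  unfolding words_def by (rule finite_lists_length_eq)

lemma words_append: "u \<in> words S N \<Longrightarrow> w \<in> words S N' \<Longrightarrow> u @ w \<in> words S (N + N')"
  by (auto simp: words_def)

lemma variable_words_append:
  "v \<in> variable_words S N \<Longrightarrow> v' \<in> variable_words S N' \<Longrightarrow> v @ v' \<in> variable_words S (N + N')"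
  "v \<in> variable_words S N \<Longrightarrow> w \<in> words S N' \<Longrightarrow> v @ map Some w \<in> variable_words S (N + N')"
  "w \<in> words S N \<Longrightarrow> v \<in> variable_words S N' \<Longrightarrow> map Some w @ v \<in> variable_words S (N + N')"
  by (auto simp: variable_words_def words_def)

lemma variable_words_mono: "S \<subseteq> T \<Longrightarrow> variable_words S N \<subseteq> variable_words T N"
  by (auto simp: variable_words_def)

text \<open>
  Colour focusing: the colour of the common point \<open>f\<close> of the \<open>s\<close> lines is either one of their
  colours, which makes a line monochromatic, or a new colour, which gives one more line. The second
  alternative is impossible for \<open>s > card C\<close>.
\<close>

lemma colour_focusing:
  fixes C :: "nat set" and S :: "'a set"
  assumes hj: "\<And>C :: nat set. finite C \<Longrightarrow>
      \<exists>N. \<forall>c. range c \<subseteq> C \<longrightarrow> (\<exists>v\<in>variable_words S N. constant_on_line c S v)"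
    and S: "finite S" and C: "finite C"
  shows "\<exists>N. \<forall>c. range c \<subseteq> C \<longrightarrow>
      (\<exists>v\<in>variable_words (insert a S) N. constant_on_line c (insert a S) v) \<or>
      (\<exists>K f. K \<subseteq> C \<and> card K = s \<and> f \<in> words (insert a S) N \<and>
        (\<forall>k\<in>K. \<exists>v\<in>variable_words (insert a S) N.
           word_subst a v = f \<and> (\<forall>x\<in>S. c (word_subst x v) = k)))"
proof (induction s)
  case 0
  have "[] \<in> words (insert a S) 0" by (simp add: words_def)
  then have "\<exists>K f. K \<subseteq> C \<and> card K = 0 \<and> f \<in> words (insert a S) 0 \<and>
        (\<forall>k\<in>K. \<exists>v\<in>variable_words (insert a S) 0.
           word_subst a v = f \<and> (\<forall>x\<in>S. c (word_subst x v) = k))" for c :: "'a list \<Rightarrow> nat"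
    by (intro exI[of _ "{}"] exI[of _ "[]"]) auto
  then show ?case by blast
next
  case (Suc s)
  let ?S = "insert a S"
  from Suc obtain N where N: "\<And>c. range c \<subseteq> C \<Longrightarrow>
      (\<exists>v\<in>variable_words ?S N. constant_on_line c ?S v) \<or>
      (\<exists>K f. K \<subseteq> C \<and> card K = s \<and> f \<in> words ?S N \<and>
        (\<forall>k\<in>K. \<exists>v\<in>variable_words ?S N.
           word_subst a v = f \<and> (\<forall>x\<in>S. c (word_subst x v) = k)))"
    by blast
  obtain ws where ws: "set ws = words ?S N"
    using finite_list finite_words S by (metis finite_insert)
  \<comment> \<open>The colour of a second half \<open>w\<close> is to be the whole list of colours
    of \<open>u @ w\<close>, with \<open>u\<close> running through the words of length
    \<open>N\<close>. Such lists are coded by numbers because \<open>hj\<close> speaks of colours in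
    \<open>nat\<close>.\<close>
  define C' where "C' = to_nat ` {ks. set ks \<subseteq> C \<and> length ks = length ws}"
  have "finite C'" unfolding C'_def using C by (simp add: finite_lists_length_eq)
  from hj[OF this] obtain N' where N': "\<And>c. range c \<subseteq> C' \<Longrightarrow>
      \<exists>v\<in>variable_words S N'. constant_on_line c S v"
    by blast
  show ?case
  proof (intro exI[of _ "N + N'"] allI impI)
    fix c :: "'a list \<Rightarrow> nat"
    assume "range c \<subseteq> C"
    then have c: "c w \<in> C" for w by blast
    let ?M = "\<exists>v\<in>variable_words ?S (N + N'). constant_on_line c ?S v"
    define c' where "c' = (\<lambda>w. to_nat (map (\<lambda>u. c (u @ w)) ws))"
    have "range c' \<subseteq> C'" using c by (auto simp: c'_def C'_def intro!: imageI)
    then obtain v' where v': "v' \<in> variable_words S N'" "constant_on_line c' S v'"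
      using N' by blast
    have v'S: "v' \<in> variable_words ?S N'" using v' variable_words_mono[of S ?S N'] by blast
    \<comment> \<open>For empty \<open>S\<close> the letter \<open>a\<close> has to stand in; the
      claim \<open>c0\<close> below is then vacuous.\<close>
    obtain x0 where x0: "x0 \<in> ?S" "S \<noteq> {} \<Longrightarrow> x0 \<in> S"
      by (cases "S = {}") auto
    define c0 where "c0 = (\<lambda>u. c (u @ word_subst x0 v'))"
    have c0: "c (u @ word_subst x v') = c0 u" if "x \<in> S" "u \<in> words ?S N" for x u
    proof -
      have "c' (word_subst x v') = c' (word_subst x0 v')"
        using v'(2) x0(2) that unfolding constant_on_line_def by blast
      then have "map (\<lambda>u. c (u @ word_subst x v')) ws = map (\<lambda>u. c (u @ word_subst x0 v')) ws"
        by (simp add: c'_def)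
      then show ?thesis using that ws by (simp add: c0_def)
    qed
    have mono: ?M if "v \<in> variable_words ?S N" "constant_on_line c0 ?S v" for v
    proof (rule bexI)
      show "constant_on_line c ?S (v @ map Some (word_subst x0 v'))"
        using that(2) by (simp only: constant_on_line_def c0_def word_subst_append word_subst_map_Some)
      show "v @ map Some (word_subst x0 v') \<in> variable_words ?S (N + N')"
        using that x0 v'S by (intro variable_words_append(2) word_subst_in_words)
    qed
    have "range c0 \<subseteq> C" using c by (auto simp: c0_def)
    from N[OF this] show "?M \<or> (\<exists>K f. K \<subseteq> C \<and> card K = Suc s \<and> f \<in> words ?S (N + N') \<and>
        (\<forall>k\<in>K. \<exists>v\<in>variable_words ?S (N + N').
           word_subst a v = f \<and> (\<forall>x\<in>S. c (word_subst x v) = k)))"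
    proof (elim disjE exE conjE)
      assume "\<exists>v\<in>variable_words ?S N. constant_on_line c0 ?S v"
      then show ?thesis using mono by blast
    next
      fix K f
      assume K: "K \<subseteq> C" "card K = s" "f \<in> words ?S N"
        and lines: "\<forall>k\<in>K. \<exists>v\<in>variable_words ?S N.
           word_subst a v = f \<and> (\<forall>x\<in>S. c0 (word_subst x v) = k)"
      show ?thesis
      proof (cases "c0 f \<in> K")
        case True
        then obtain v where "v \<in> variable_words ?S N" "word_subst a v = f"
            "\<forall>x\<in>S. c0 (word_subst x v) = c0 f"
          using lines by blast
        then have ?M by (intro mono) (auto simp: constant_on_line_def)
        then show ?thesis ..
      next
        case False
        have "finite K" using K C finite_subset by blast
        have f': "f @ word_subst a v' \<in> words ?S (N + N')"
          using K(3) v'S by (intro words_append word_subst_in_words) auto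
        \<comment> \<open>The new line keeps \<open>f\<close> fixed and moves in the second half
          only; the old lines move in both halves at once. So all of them meet at the letter
          \<open>a\<close> in the point \<open>f @ word_subst a v'\<close>.\<close>
        have "\<exists>v\<in>variable_words ?S (N + N'). word_subst a v = f @ word_subst a v' \<and>
            (\<forall>x\<in>S. c (word_subst x v) = k)" if k: "k \<in> insert (c0 f) K" for k
        proof (cases "k = c0 f")
          case True
          then show ?thesis
            using c0[OF _ K(3)] variable_words_append(3)[OF K(3) v'S]
            by (intro bexI[of _ "map Some f @ v'"]) simp_all
        next
          case False
          then obtain v where v: "v \<in> variable_words ?S N" "word_subst a v = f"
              "\<forall>x\<in>S. c0 (word_subst x v) = k"
            using lines k by blast
          then have "c (word_subst x v @ word_subst x v') = k" if "x \<in> S" for x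
            using c0[OF that, of "word_subst x v"] word_subst_in_words[OF v(1)] that by simp
          then show ?thesis
            using v(2) variable_words_append(1)[OF v(1) v'S]
            by (intro bexI[of _ "v @ v'"]) simp_all
        qed
        moreover have "insert (c0 f) K \<subseteq> C" "card (insert (c0 f) K) = Suc s"
          using K False \<open>finite K\<close> \<open>range c0 \<subseteq> C\<close> by auto
        ultimately show ?thesis using f' by blast
      qed
    qed
  qed
qed

text \<open>Induction on the alphabet. The colour set stays arbitrary, since colour focusing applies
  the smaller alphabet with far more colours.\<close>

theorem hales_jewett:
  fixes C :: "nat set" and S :: "'a set"
  assumes "finite S" "finite C"
  shows "\<exists>N. \<forall>c. range c \<subseteq> C \<longrightarrow> (\<exists>v\<in>variable_words S N. constant_on_line c S v)"
  using assms
proof (induction S arbitrary: C rule: finite_induct)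
  case empty
  have "[None] \<in> variable_words {} 1" by (simp add: variable_words_def)
  then show ?case by (auto simp: constant_on_line_def)
next
  case (insert a S)
  obtain N where N: "\<And>c. range c \<subseteq> C \<Longrightarrow>
      (\<exists>v\<in>variable_words (insert a S) N. constant_on_line c (insert a S) v) \<or>
      (\<exists>K f. K \<subseteq> C \<and> card K = Suc (card C) \<and> f \<in> words (insert a S) N \<and>
        (\<forall>k\<in>K. \<exists>v\<in>variable_words (insert a S) N.
           word_subst a v = f \<and> (\<forall>x\<in>S. c (word_subst x v) = k)))"
    using colour_focusing[OF insert.IH \<open>finite S\<close> \<open>finite C\<close>, of a "Suc (card C)"] by blast
  have "card K \<noteq> Suc (card C)" if "K \<subseteq> C" for K
    using card_mono[OF \<open>finite C\<close> that] by simp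
  then have "\<exists>v\<in>variable_words (insert a S) N. constant_on_line c (insert a S) v" if "range c \<subseteq> C" for c
    using N[OF that] by fast
  then show ?case by (intro exI[of _ N]) simp
qed

section \<open>J-sets\<close>

lemma pos_iff: "x \<in> pos \<longleftrightarrow> x \<noteq> 0"
  by (auto simp: pos_def)

lemma pos_add [simp]: "y \<in> pos \<Longrightarrow> x + y \<in> pos"
  by (simp add: pos_iff)

lemma J_set_mono: "J_set A \<Longrightarrow> A \<subseteq> B \<Longrightarrow> B \<subseteq> pos \<Longrightarrow> J_set B"
  unfolding J_set_def by (meson subset_iff)

lemma pos_funs_val: "f \<in> pos_funs \<Longrightarrow> t \<noteq> 0 \<Longrightarrow> f t \<noteq> 0"
  by (auto simp: pos_funs_def PiE_def Pi_def pos_iff)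

lemma restrict_in_pos_funs: "(\<And>t. t \<in> pos \<Longrightarrow> f t \<in> pos) \<Longrightarrow> restrict f pos \<in> pos_funs"
  by (auto simp: pos_funs_def)

lemma not_J_set_empty: "\<not> J_set {}"
proof
  assume "J_set {}"
  moreover have "{\<lambda>t\<in>pos. 1} \<in> Pf pos_funs"
    by (auto simp: pos_iff Pf_def intro!: restrict_in_pos_funs)
  ultimately show False unfolding J_set_def by blast
qed

lemma J_setE:
  assumes "J_set A" "F \<in> Pf pos_funs"
  obtains a \<beta> where "a \<in> pos" "\<beta> \<in> Pf pos" "\<And>f. f \<in> F \<Longrightarrow> a + sum f \<beta> \<in> A"
proof -
  have "\<exists>a\<in>pos. \<exists>\<beta>\<in>Pf pos. \<forall>f\<in>F. a + sum f \<beta> \<in> A"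
    using assms by (simp only: J_set_def)
  then show thesis using that by (elim bexE) simp
qed

lemma not_J_setE:
  assumes "\<not> J_set A" "A \<subseteq> pos"
  obtains F where "F \<in> Pf pos_funs"
    "\<And>a \<beta>. a \<in> pos \<Longrightarrow> \<beta> \<in> Pf pos \<Longrightarrow> \<exists>f\<in>F. a + sum f \<beta> \<notin> A"
proof -
  have "\<exists>F\<in>Pf pos_funs. \<forall>a\<in>pos. \<forall>\<beta>\<in>Pf pos. \<exists>f\<in>F. a + sum f \<beta> \<notin> A"
    using assms by (simp only: J_set_def simp_thms ball_simps bex_simps)
  then show thesis using that by (elim bexE) simp
qed

text \<open>Replacing each \<open>f\<close> by its translate \<open>t \<mapsto> f (t + d)\<close>
  moves the block past \<open>d\<close>. This later separates \<open>H j F\<close> from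
  \<open>H j K\<close> for \<open>F \<subset> K\<close>.\<close>

lemma J_set_beyond:
  assumes "J_set A" "F \<in> Pf pos_funs"
  obtains a \<beta> where "a \<in> pos" "\<beta> \<in> Pf pos" "d < Min \<beta>" "\<And>f. f \<in> F \<Longrightarrow> a + sum f \<beta> \<in> A"
proof -
  define g where "g = (\<lambda>f :: nat \<Rightarrow> nat. \<lambda>t\<in>pos. f (t + d))"
  have "g f \<in> pos_funs" if "f \<in> F" for f
    unfolding g_def using assms that by (intro restrict_in_pos_funs) (auto simp: pos_iff Pf_def pos_funs_val)
  then have "g ` F \<in> Pf pos_funs" using assms by (auto simp: pos_iff Pf_def)
  from J_setE[OF assms(1) this] obtain a \<beta>
    where a: "a \<in> pos" and \<beta>: "\<beta> \<in> Pf pos" "\<And>f. f \<in> F \<Longrightarrow> a + sum (g f) \<beta> \<in> A"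
    by (metis imageI)
  have \<beta>': "finite \<beta>" "\<beta> \<noteq> {}" "\<beta> \<subseteq> pos" using \<beta> by (auto simp: pos_iff Pf_def)
  show ?thesis
  proof
    show "(\<lambda>t. t + d) ` \<beta> \<in> Pf pos" using \<beta>' by (auto simp: pos_iff Pf_def)
    show "d < Min ((\<lambda>t. t + d) ` \<beta>)" using \<beta>' by (auto simp: pos_iff intro!: Nat.gr0I)
    show "a + sum f ((\<lambda>t. t + d) ` \<beta>) \<in> A" if "f \<in> F" for f
    proof -
      have "sum f ((\<lambda>t. t + d) ` \<beta>) = sum (g f) \<beta>"
        using \<beta>' by (subst sum.reindex) (auto simp: g_def intro!: sum.cong)
      then show ?thesis using \<beta>(2)[OF that] by simp
    qed
  qed (fact a)
qed

text \<open>
  A word \<open>w\<close> over \<open>F\<close> is turned into the function \<open>t \<mapsto> (\<Sum>i<N. w\<^sub>i (N t + i))\<close>;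
  the variable positions of a variable word then contribute a block sum of the substituted
  letter and the fixed positions contribute a constant.
\<close>

lemma J_set_Un:
  assumes "J_set (A \<union> B)"
  shows "J_set A \<or> J_set B"
proof (rule ccontr)
  assume "\<not> (J_set A \<or> J_set B)"
  moreover have "A \<subseteq> pos" "B \<subseteq> pos" using assms by (auto simp: J_set_def)
  ultimately obtain F1 F2 where F1: "F1 \<in> Pf pos_funs"
      "\<And>a \<beta>. a \<in> pos \<Longrightarrow> \<beta> \<in> Pf pos \<Longrightarrow> \<exists>f\<in>F1. a + sum f \<beta> \<notin> A"
    and F2: "F2 \<in> Pf pos_funs"
      "\<And>a \<beta>. a \<in> pos \<Longrightarrow> \<beta> \<in> Pf pos \<Longrightarrow> \<exists>f\<in>F2. a + sum f \<beta> \<notin> B"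
    by (metis not_J_setE)
  \<comment> \<open>A block whose sums over \<open>F\<close> all lie in \<open>A\<close> contradicts
    \<open>F1\<close>, and one whose sums all lie in \<open>B\<close> contradicts \<open>F2\<close>.
    Two colours therefore suffice.\<close>
  define F where "F = F1 \<union> F2"
  have F: "finite F" "F \<noteq> {}" "F \<subseteq> pos_funs" using F1(1) F2(1) by (auto simp: F_def Pf_def)
  obtain N where N: "\<And>c. range c \<subseteq> {0, 1::nat} \<Longrightarrow> \<exists>v\<in>variable_words F N. constant_on_line c F v"
    using hales_jewett[OF F(1), of "{0, 1}"] by auto
  have "N \<noteq> 0" using N[of "\<lambda>_. 0"] by (auto simp: variable_words_def)
  \<comment> \<open>The argument \<open>N * t + i\<close> determines both \<open>t\<close> and
    \<open>i < N\<close>. Hence the terms at the variable positions are a sum of one letter over a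
    genuine set, which is \<open>\<gamma>\<close> below.\<close>
  define g where "g = (\<lambda>w :: (nat \<Rightarrow> nat) list. \<lambda>t\<in>pos. \<Sum>i<N. (w ! i) (N * t + i))"
  have "g w \<in> pos_funs" if "w \<in> words F N" for w
    unfolding g_def
  proof (intro restrict_in_pos_funs)
    fix t assume "t \<in> pos"
    have "w ! 0 \<in> pos_funs" using that F \<open>N \<noteq> 0\<close> by (auto simp: words_def in_mono)
    then have "(w ! 0) (N * t + 0) \<noteq> 0"
      by (rule pos_funs_val) (use \<open>t \<in> pos\<close> \<open>N \<noteq> 0\<close> in \<open>simp add: pos_iff\<close>)
    then show "(\<Sum>i<N. (w ! i) (N * t + i)) \<in> pos" using \<open>N \<noteq> 0\<close> by (auto simp: pos_iff intro!: bexI[of _ 0])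
  qed
  moreover obtain f0 where "f0 \<in> F" using F by blast
  then have "replicate N f0 \<in> words F N" by (auto simp: words_def)
  ultimately have "g ` words F N \<in> Pf pos_funs"
    using finite_words[OF F(1), of N] by (auto simp: pos_iff Pf_def)
  from J_setE[OF assms this] obtain a \<beta> where a: "a \<in> pos" and \<beta>: "\<beta> \<in> Pf pos"
    and w: "\<And>w. w \<in> words F N \<Longrightarrow> a + sum (g w) \<beta> \<in> A \<union> B"
    by (metis imageI)
  define c where "c = (\<lambda>w. if a + sum (g w) \<beta> \<in> A then 0 else 1 :: nat)"
  obtain v where v: "v \<in> variable_words F N" "constant_on_line c F v"
    using N[of c] by (auto simp: c_def)
  have [simp]: "length v = N" using v by (simp add: variable_words_def)
  have \<beta>': "finite \<beta>" "\<beta> \<noteq> {}" "\<beta> \<subseteq> pos" using \<beta> by (auto simp: pos_iff Pf_def)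
  define V where "V = {i. i < N \<and> v ! i = None}"
  define a' where "a' = a + (\<Sum>t\<in>\<beta>. \<Sum>i\<in>{..<N} - V. the (v ! i) (N * t + i))"
  define \<gamma> where "\<gamma> = (\<lambda>(t, i). N * t + i) ` (\<beta> \<times> V)"
  have "V \<subseteq> {..<N}" "finite V" by (auto simp: V_def)
  have "V \<noteq> {}" using v(1) by (auto simp: V_def variable_words_def in_set_conv_nth)
  have "inj_on (\<lambda>(t, i). N * t + i) (\<beta> \<times> V)"
  proof (rule inj_onI, clarify)
    fix t i t' i' assume "i \<in> V" "i' \<in> V" and eq: "N * t + i = N * t' + i'"
    then have "i < N" "i' < N" by (auto simp: V_def)
    then have "(N * t + i) div N = t" "(N * t' + i') div N = t'" by auto
    then have "t = t'" using eq by simp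
    then show "t = t' \<and> i = i'" using eq by simp
  qed
  then have sum_\<gamma>: "sum f \<gamma> = (\<Sum>t\<in>\<beta>. \<Sum>i\<in>V. f (N * t + i))" for f :: "nat \<Rightarrow> nat"
    unfolding \<gamma>_def by (subst sum.reindex) (auto simp: sum.cartesian_product split_beta)
  have "\<gamma> \<in> Pf pos" using \<beta>' \<open>finite V\<close> \<open>V \<noteq> {}\<close> \<open>N \<noteq> 0\<close> by (auto simp: pos_iff Pf_def \<gamma>_def)
  have "a' \<in> pos" using a by (simp add: a'_def pos_iff)
  have eq: "a + sum (g (word_subst f v)) \<beta> = a' + sum f \<gamma>" for f
  proof -
    have "g (word_subst f v) t
        = (\<Sum>i\<in>{..<N} - V. the (v ! i) (N * t + i)) + (\<Sum>i\<in>V. f (N * t + i))"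
      if "t \<in> \<beta>" for t
    proof -
      have "g (word_subst f v) t = (\<Sum>i<N. (word_subst f v ! i) (N * t + i))"
        using that \<beta>' by (auto simp: g_def)
      also have "\<dots> = (\<Sum>i\<in>{..<N} - V. (word_subst f v ! i) (N * t + i))
          + (\<Sum>i\<in>V. (word_subst f v ! i) (N * t + i))"
        using \<open>V \<subseteq> {..<N}\<close> by (intro sum.subset_diff) auto
      also have "(\<Sum>i\<in>{..<N} - V. (word_subst f v ! i) (N * t + i))
          = (\<Sum>i\<in>{..<N} - V. the (v ! i) (N * t + i))"
        by (intro sum.cong) (auto simp: word_subst_def V_def)
      also have "(\<Sum>i\<in>V. (word_subst f v ! i) (N * t + i)) = (\<Sum>i\<in>V. f (N * t + i))"
        by (intro sum.cong) (auto simp: word_subst_def V_def)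
      finally show ?thesis .
    qed
    then show ?thesis by (simp add: sum_\<gamma> a'_def sum.distrib)
  qed
  have "a' + sum f \<gamma> \<in> A \<union> B" if "f \<in> F" for f
    using w[OF word_subst_in_words[OF v(1) that]] eq by simp
  moreover have "a' + sum f \<gamma> \<in> A \<longleftrightarrow> a' + sum f' \<gamma> \<in> A" if "f \<in> F" "f' \<in> F" for f f'
  proof -
    have "c (word_subst f v) = c (word_subst f' v)"
      using v(2) that unfolding constant_on_line_def by blast
    then show ?thesis by (simp add: c_def eq split: if_splits)
  qed
  ultimately have "(\<forall>f\<in>F. a' + sum f \<gamma> \<in> A) \<or> (\<forall>f\<in>F. a' + sum f \<gamma> \<in> B)" by blast
  then show False
    using F1(2)[OF \<open>a' \<in> pos\<close> \<open>\<gamma> \<in> Pf pos\<close>] F2(2)[OF \<open>a' \<in> pos\<close> \<open>\<gamma> \<in> Pf pos\<close>]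
    by (auto simp: F_def)
qed

section \<open>Ultrafilters\<close>

text \<open>Zorn's lemma gives a maximal family whose finite intersections satisfy \<open>R\<close>.
  If it contained neither \<open>A\<close> nor \<open>X - A\<close>, each would be refuted by a
  finite subfamily, and the intersection of both subfamilies would split into two pieces outside
  \<open>R\<close>, against partition regularity. The instances are nonemptiness and
  \<open>J_set\<close>.\<close>

lemma ultrafilter_extending:
  fixes R :: "'a set \<Rightarrow> bool"
  assumes up: "\<And>A B. R A \<Longrightarrow> A \<subseteq> B \<Longrightarrow> B \<subseteq> X \<Longrightarrow> R B"
    and Un: "\<And>A B. R (A \<union> B) \<Longrightarrow> R A \<or> R B"
    and empty: "\<not> R {}"
    and F: "F \<subseteq> Pow X" "\<And>G. finite G \<Longrightarrow> G \<subseteq> F \<Longrightarrow> R (X \<inter> \<Inter>G)"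
  obtains p where "ultrafilter_on X p" "F \<subseteq> p" "\<And>A. A \<in> p \<Longrightarrow> R A"
proof -
  define \<A> where "\<A> = {M. F \<subseteq> M \<and> M \<subseteq> Pow X \<and> (\<forall>G. finite G \<longrightarrow> G \<subseteq> M \<longrightarrow> R (X \<inter> \<Inter>G))}"
  have "\<exists>M\<in>\<A>. \<forall>Y\<in>\<A>. M \<subseteq> Y \<longrightarrow> Y = M"
  proof (rule subset_Zorn_nonempty)
    have "F \<in> \<A>" using F by (simp add: \<A>_def)
    then show "\<A> \<noteq> {}" by blast
    fix \<C> assume "\<C> \<noteq> {}" and ch: "subset.chain \<A> \<C>"
    then have "\<C> \<subseteq> \<A>" by (simp add: subset.chain_def)
    have "R (X \<inter> \<Inter>G)" if G: "finite G" "G \<subseteq> \<Union>\<C>" for G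
    proof -
      obtain M where "M \<in> \<C>" "G \<subseteq> M"
        using finite_subset_Union_chain[OF G \<open>\<C> \<noteq> {}\<close> ch] by blast
      then show ?thesis using \<open>\<C> \<subseteq> \<A>\<close> G(1) by (auto simp: \<A>_def)
    qed
    moreover have "F \<subseteq> M \<and> M \<subseteq> Pow X" if "M \<in> \<C>" for M
      using that \<open>\<C> \<subseteq> \<A>\<close> by (auto simp: \<A>_def)
    then have "F \<subseteq> \<Union>\<C>" "\<Union>\<C> \<subseteq> Pow X" using \<open>\<C> \<noteq> {}\<close> by blast+
    ultimately show "\<Union>\<C> \<in> \<A>" by (simp add: \<A>_def)
  qed
  then obtain M where "M \<in> \<A>" and max: "\<And>Y. Y \<in> \<A> \<Longrightarrow> M \<subseteq> Y \<Longrightarrow> Y = M"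
    by blast
  then have M: "F \<subseteq> M" "M \<subseteq> Pow X" "\<And>G. finite G \<Longrightarrow> G \<subseteq> M \<Longrightarrow> R (X \<inter> \<Inter>G)"
    by (simp_all add: \<A>_def)
  have outside: "\<exists>G. finite G \<and> G \<subseteq> M \<and> \<not> R (X \<inter> \<Inter>G \<inter> B)" if "B \<subseteq> X" "B \<notin> M" for B
  proof (rule ccontr)
    assume *: "\<nexists>G. finite G \<and> G \<subseteq> M \<and> \<not> R (X \<inter> \<Inter>G \<inter> B)"
    have "R (X \<inter> \<Inter>G)" if G: "finite G" "G \<subseteq> insert B M" for G
    proof -
      have "R (X \<inter> \<Inter>(G - {B}) \<inter> B)" using * G by blast
      then show ?thesis by (rule up) auto
    qed
    then have "insert B M \<in> \<A>" using M \<open>B \<subseteq> X\<close> by (auto simp: \<A>_def)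
    then show False using max \<open>B \<notin> M\<close> by blast
  qed
  \<comment> \<open>The filter axioms are the cases of no set, one set and two sets in
    \<open>G\<close>.\<close>
  have inside: "B \<in> M" if B: "B \<subseteq> X" "finite G" "G \<subseteq> M" "X \<inter> \<Inter>G \<subseteq> B" for B G
  proof (rule ccontr)
    assume "B \<notin> M"
    then obtain G' where G': "finite G'" "G' \<subseteq> M" "\<not> R (X \<inter> \<Inter>G' \<inter> B)" using outside[OF B(1) \<open>B \<notin> M\<close>] by blast
    have "R (X \<inter> \<Inter>(G \<union> G'))" using B G' by (intro M(3)) auto
    then have "R (X \<inter> \<Inter>G' \<inter> B)" by (rule up) (use B in auto)
    then show False using G' by blast
  qed
  have R: "R A" if "A \<in> M" for A
    using M(3)[of "{A}"] M(2) that up[of "X \<inter> A" A] by auto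
  have ultra: "A \<in> M \<or> X - A \<in> M" if A: "A \<subseteq> X" for A
  proof (rule ccontr)
    assume "\<not> (A \<in> M \<or> X - A \<in> M)"
    then obtain G G' where G: "finite G" "G \<subseteq> M" "\<not> R (X \<inter> \<Inter>G \<inter> A)"
        "finite G'" "G' \<subseteq> M" "\<not> R (X \<inter> \<Inter>G' \<inter> (X - A))"
      using outside[OF A] outside[of "X - A"] by blast
    have "R (X \<inter> \<Inter>(G \<union> G'))" using G by (intro M(3)) auto
    then have "R ((X \<inter> \<Inter>G \<inter> A) \<union> (X \<inter> \<Inter>G' \<inter> (X - A)))"
      by (rule up) (use A in auto)
    then show False using Un G by blast
  qed
  have "ultrafilter_on X M"
    unfolding ultrafilter_on_def
  proof (intro conjI allI impI)
    show "X \<in> M" by (rule inside[of _ "{}"]) auto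
    show "{} \<notin> M" using R empty by blast
    show "B \<in> M" if "A \<in> M" "A \<subseteq> B" "B \<subseteq> X" for A B
      by (rule inside[of _ "{A}"]) (use that in auto)
    show "A \<inter> B \<in> M" if "A \<in> M" "B \<in> M" for A B
      by (rule inside[of _ "{A, B}"]) (use that M(2) in auto)
  qed (use M ultra in auto)
  then show thesis using that M(1) R by blast
qed

lemma beta_posD:
  assumes "p \<in> beta_pos"
  shows beta_pos_subset: "A \<in> p \<Longrightarrow> A \<subseteq> pos"
    and beta_pos_pos: "pos \<in> p"
    and beta_pos_empty: "{} \<notin> p"
    and beta_pos_mono: "A \<in> p \<Longrightarrow> A \<subseteq> B \<Longrightarrow> B \<subseteq> pos \<Longrightarrow> B \<in> p"
    and beta_pos_Int: "A \<in> p \<Longrightarrow> B \<in> p \<Longrightarrow> A \<inter> B \<in> p"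
    and beta_pos_ultra: "A \<subseteq> pos \<Longrightarrow> A \<in> p \<or> pos - A \<in> p"
proof -
  have "ultrafilter_on pos p" using assms by (simp add: beta_pos_def)
  note u = this[unfolded ultrafilter_on_def]
  show "A \<in> p \<Longrightarrow> A \<subseteq> pos" using conjunct1[OF u] by blast
  show "pos \<in> p" "{} \<notin> p" using u by simp_all
  show "A \<in> p \<Longrightarrow> A \<subseteq> B \<Longrightarrow> B \<subseteq> pos \<Longrightarrow> B \<in> p" using u by meson
  show "A \<in> p \<Longrightarrow> B \<in> p \<Longrightarrow> A \<inter> B \<in> p" using u by meson
  show "A \<subseteq> pos \<Longrightarrow> A \<in> p \<or> pos - A \<in> p" using u by meson
qed

lemma beta_pos_Inter:
  assumes "p \<in> beta_pos" "finite G" "G \<subseteq> p"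
  shows "pos \<inter> \<Inter>G \<in> p"
  using assms(2,3)
proof (induction G rule: finite_induct)
  case empty
  then show ?case using beta_pos_pos[OF assms(1)] by simp
next
  case (insert A G)
  then have "A \<inter> (pos \<inter> \<Inter>G) \<in> p" using beta_pos_Int[OF assms(1)] by blast
  then show ?case by (simp add: Int_left_commute)
qed

lemma beta_pos_compl:
  assumes "p \<in> beta_pos" "A \<subseteq> pos"
  shows "pos - A \<in> p \<longleftrightarrow> A \<notin> p"
proof
  assume "pos - A \<in> p"
  show "A \<notin> p"
  proof
    assume "A \<in> p"
    then have "A \<inter> (pos - A) \<in> p" using beta_pos_Int[OF assms(1)] \<open>pos - A \<in> p\<close> by blast
    then show False using beta_pos_empty[OF assms(1)] by simp
  qed
qed (use beta_pos_ultra[OF assms] in blast)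

lemma beta_pos_eqI:
  assumes "p \<in> beta_pos" "q \<in> beta_pos" "p \<subseteq> q"
  shows "p = q"
  using assms beta_pos_compl beta_pos_subset by (metis Diff_subset subsetD subsetI subset_antisym)

lemma beta_pos_exists:
  assumes "F \<subseteq> Pow pos" "\<And>G. finite G \<Longrightarrow> G \<subseteq> F \<Longrightarrow> pos \<inter> \<Inter>G \<noteq> {}"
  obtains p where "p \<in> beta_pos" "F \<subseteq> p"
  by (rule ultrafilter_extending[of "\<lambda>A. A \<noteq> {}" pos F]) (use assms in \<open>auto simp: beta_pos_def\<close>)

section \<open>Shifts and the sum of ultrafilters\<close>

lemma shift_subset: "shift x A \<subseteq> pos"
  by (auto simp: shift_def)

lemma shift_Int: "shift x (A \<inter> B) = shift x A \<inter> shift x B"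
  by (auto simp: shift_def)

lemma shift_compl: "shift x (pos - A) = pos - shift x A"
  by (auto simp: shift_def)

lemma shift_shift: "x \<in> pos \<Longrightarrow> shift y (shift x A) = shift (x + y) A"
  by (auto simp: shift_def add.assoc)

text \<open>The map \<open>?S\<close> respects intersections and complements because membership in
  the ultrafilter \<open>q\<close> does. So the sum is the preimage of \<open>p\<close> under a
  Boolean homomorphism.\<close>

lemma uf_plus_beta_pos:
  assumes p: "p \<in> beta_pos" and q: "q \<in> beta_pos"
  shows "uf_plus p q \<in> beta_pos"
proof -
  let ?S = "\<lambda>A. {x \<in> pos. shift x A \<in> q}"
  have S_pos: "?S pos = pos"
  proof -
    have "shift x pos = pos" for x by (auto simp: shift_def)
    then show ?thesis by (simp only: beta_pos_pos[OF q] simp_thms Collect_mem_eq)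
  qed
  have S_empty: "?S {} = {}" using beta_pos_empty[OF q] by (simp add: shift_def)
  have S_mono: "?S A \<subseteq> ?S B" if "A \<subseteq> B" for A B
  proof -
    have "shift x A \<subseteq> shift x B" for x using that by (auto simp: shift_def)
    then show ?thesis using beta_pos_mono[OF q _ _ shift_subset] by blast
  qed
  have S_Int: "?S (A \<inter> B) = ?S A \<inter> ?S B" for A B
    using beta_pos_Int[OF q] beta_pos_mono[OF q _ _ shift_subset] by (auto simp: shift_Int)
  have S_compl: "?S (pos - A) = pos - ?S A" for A
    using beta_pos_compl[OF q shift_subset] by (auto simp: shift_compl)
  have mem: "A \<in> uf_plus p q \<longleftrightarrow> A \<subseteq> pos \<and> ?S A \<in> p" for A
    by (simp only: uf_plus_def mem_Collect_eq)
  have "ultrafilter_on pos (uf_plus p q)"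
    unfolding ultrafilter_on_def
  proof (intro conjI allI impI)
    show "uf_plus p q \<subseteq> Pow pos" using mem by blast
    show "pos \<in> uf_plus p q" using beta_pos_pos[OF p] by (simp only: mem S_pos subset_refl simp_thms)
    show "{} \<notin> uf_plus p q" using beta_pos_empty[OF p] by (simp only: mem S_empty simp_thms)
    show "B \<in> uf_plus p q" if "A \<in> uf_plus p q" "A \<subseteq> B" "B \<subseteq> pos" for A B
      using that mem beta_pos_mono[OF p _ S_mono[of A B]] by auto
    show "A \<inter> B \<in> uf_plus p q" if "A \<in> uf_plus p q" "B \<in> uf_plus p q" for A B
    proof -
      have "?S A \<inter> ?S B \<in> p" using that by (intro beta_pos_Int[OF p]) (simp_all only: mem)
      then show ?thesis using that by (simp only: mem S_Int) blast
    qed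
    show "A \<in> uf_plus p q \<or> pos - A \<in> uf_plus p q" if "A \<subseteq> pos" for A
      using that beta_pos_ultra[OF p, of "?S A"] by (simp only: mem S_compl) blast
  qed
  then show ?thesis by (simp add: beta_pos_def)
qed

lemma uf_plus_assoc: "uf_plus (uf_plus p q) r = uf_plus p (uf_plus q r)"
proof -
  have "shift x {z \<in> pos. shift z A \<in> r} = {y \<in> pos. shift y (shift x A) \<in> r}" if "x \<in> pos" for x A
    using that by (auto simp: shift_shift shift_def[of x "Collect _"])
  then show ?thesis
    by (auto simp: uf_plus_def shift_subset cong: conj_cong)
qed

section \<open>Closed subsemigroups and their idempotents\<close>

text \<open>
  Closed sets of ultrafilters are represented by the families of sets common to their
  members; minimal closed subsemigroups correspond to maximal families.
\<close>

definition uf_closed :: "nat set set \<Rightarrow> nat set set set" where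
  "uf_closed F = {p \<in> beta_pos. F \<subseteq> p}"

definition semigroup_family :: "nat set set \<Rightarrow> bool" where
  "semigroup_family F \<longleftrightarrow> F \<subseteq> Pow pos \<and> uf_closed F \<noteq> {} \<and>
     (\<forall>p \<in> uf_closed F. \<forall>q \<in> uf_closed F. uf_plus p q \<in> uf_closed F)"

text \<open>A finite part of the union lies in one member of the chain, so by compactness a
  decreasing chain of closed subsemigroups has nonempty intersection. This is the chain condition
  for Zorn's lemma.\<close>

lemma semigroup_family_Union_chain:
  assumes "\<C> \<noteq> {}" and ch: "subset.chain \<A> \<C>" and sg: "\<And>F. F \<in> \<C> \<Longrightarrow> semigroup_family F"
  shows "semigroup_family (\<Union>\<C>)"
proof -
  have sub: "\<Union>\<C> \<subseteq> Pow pos" using sg unfolding semigroup_family_def by blast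
  have "pos \<inter> \<Inter>G \<noteq> {}" if G: "finite G" "G \<subseteq> \<Union>\<C>" for G
  proof -
    obtain F where F: "F \<in> \<C>" "G \<subseteq> F"
      using finite_subset_Union_chain[OF G \<open>\<C> \<noteq> {}\<close> ch] by blast
    then obtain p where p: "p \<in> beta_pos" "F \<subseteq> p"
      using sg[OF F(1)] by (auto simp: semigroup_family_def uf_closed_def)
    then have "pos \<inter> \<Inter>G \<in> p" using beta_pos_Inter[OF p(1) G(1)] F by blast
    then show ?thesis using beta_pos_empty[OF p(1)] by auto
  qed
  then obtain p where "p \<in> beta_pos" "\<Union>\<C> \<subseteq> p" by (rule beta_pos_exists[OF sub]) blast+
  then have "uf_closed (\<Union>\<C>) \<noteq> {}" by (auto simp: uf_closed_def)
  moreover have mem: "p \<in> uf_closed (\<Union>\<C>) \<longleftrightarrow> (\<forall>F\<in>\<C>. p \<in> uf_closed F)" for p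
    using \<open>\<C> \<noteq> {}\<close> by (auto simp: uf_closed_def)
  have "uf_plus p q \<in> uf_closed (\<Union>\<C>)" if "p \<in> uf_closed (\<Union>\<C>)" "q \<in> uf_closed (\<Union>\<C>)" for p q
    using that sg by (simp add: mem semigroup_family_def)
  ultimately show ?thesis using sub by (simp add: semigroup_family_def)
qed

text \<open>Ellis' theorem: in a minimal closed subsemigroup every element is idempotent.\<close>

theorem idempotent_in_closed_subsemigroup:
  assumes "semigroup_family F"
  obtains p where "p \<in> uf_closed F" "uf_plus p p = p"
proof -
  have "\<exists>M\<in>{M. F \<subseteq> M \<and> semigroup_family M}.
      \<forall>Y\<in>{M. F \<subseteq> M \<and> semigroup_family M}. M \<subseteq> Y \<longrightarrow> Y = M"
  proof (rule subset_Zorn_nonempty)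
    show "{M. F \<subseteq> M \<and> semigroup_family M} \<noteq> {}" using assms by blast
    fix \<C> assume C: "\<C> \<noteq> {}" "subset.chain {M. F \<subseteq> M \<and> semigroup_family M} \<C>"
    then have "F \<subseteq> M \<and> semigroup_family M" if "M \<in> \<C>" for M
      using that by (auto simp: subset.chain_def)
    then show "\<Union>\<C> \<in> {M. F \<subseteq> M \<and> semigroup_family M}"
      using semigroup_family_Union_chain[OF C] C(1) by blast
  qed
  then obtain M where "F \<subseteq> M" and M: "semigroup_family M"
    and max: "\<And>Y. semigroup_family Y \<Longrightarrow> M \<subseteq> Y \<Longrightarrow> Y = M"
    by (smt (verit) mem_Collect_eq subset_trans)
  then have MP: "M \<subseteq> Pow pos"
    and plus: "\<And>p q. p \<in> uf_closed M \<Longrightarrow> q \<in> uf_closed M \<Longrightarrow> uf_plus p q \<in> uf_closed M"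
    by (auto simp: semigroup_family_def)
  obtain p where p: "p \<in> uf_closed M" using M by (auto simp: semigroup_family_def)
  then have pb: "p \<in> beta_pos" by (simp add: uf_closed_def)
  let ?S = "\<lambda>B. {x \<in> pos. shift x B \<in> p}"
  have plus_p: "B \<in> uf_plus q p \<longleftrightarrow> B \<subseteq> pos \<and> ?S B \<in> q" for B q
    by (simp only: uf_plus_def mem_Collect_eq)
  define E where "E = M \<union> {B. B \<subseteq> pos \<and> (\<forall>q\<in>uf_closed M. ?S B \<in> q)}"
  \<comment> \<open>The closed set of \<open>E\<close> is the translate of that of \<open>M\<close> by \<open>p\<close>.\<close>
  have E_D: "\<exists>q\<in>uf_closed M. r = uf_plus q p" if r: "r \<in> uf_closed E" for r
  proof -
    have rb: "r \<in> beta_pos" and "M \<subseteq> r" and E: "E \<subseteq> r" using r by (auto simp: uf_closed_def E_def)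
    \<comment> \<open>An ultrafilter \<open>q\<close> with \<open>uf_plus q p = r\<close> has to
      contain \<open>M\<close> and all \<open>?S B\<close> with \<open>B \<in> r\<close>. If
      finitely many of these had empty intersection, then the intersection \<open>B\<close> of the
      sets of \<open>r\<close> involved would have its complement in every
      \<open>uf_plus q p\<close>, hence in \<open>E\<close> and in \<open>r\<close>.\<close>
    have "pos \<inter> \<Inter>G \<noteq> {}" if G: "finite G" "G \<subseteq> M \<union> ?S ` r" for G
    proof
      assume empty: "pos \<inter> \<Inter>G = {}"
      obtain D where D: "D \<subseteq> r" "finite D" "G - M = ?S ` D"
        using G finite_subset_image[of "G - M" ?S r] by blast
      define B where "B = pos \<inter> \<Inter>D"
      have "B \<in> r" unfolding B_def using D beta_pos_Inter[OF rb] by blast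
      have "?S (pos - B) \<in> q" if q: "q \<in> uf_closed M" for q
      proof (rule ccontr)
        assume "?S (pos - B) \<notin> q"
        have qb: "q \<in> beta_pos" and Mq: "M \<subseteq> q" using q by (auto simp: uf_closed_def)
        have "uf_plus q p \<in> beta_pos" using qb pb by (rule uf_plus_beta_pos)
        moreover have "pos - B \<notin> uf_plus q p" using \<open>?S (pos - B) \<notin> q\<close> plus_p by blast
        ultimately have B: "B \<in> uf_plus q p" using beta_pos_compl[of "uf_plus q p" B] by (auto simp: B_def)
        have "?S A \<in> q" if "A \<in> D" for A
        proof -
          have "A \<subseteq> pos" using that D beta_pos_subset[OF rb] by blast
          then have "A \<in> uf_plus q p"
            using beta_pos_mono[OF \<open>uf_plus q p \<in> beta_pos\<close> B] that by (auto simp: B_def)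
          then show ?thesis using plus_p by blast
        qed
        then have "G - M \<subseteq> q" unfolding D(3) by blast
        then have "G \<subseteq> q" using Mq by blast
        then have "pos \<inter> \<Inter>G \<in> q" using beta_pos_Inter[OF qb G(1)] by blast
        then show False using empty beta_pos_empty[OF qb] by simp
      qed
      then have "pos - B \<in> E" by (auto simp: E_def)
      then show False using E \<open>B \<in> r\<close> beta_pos_compl[OF rb, of B] by (auto simp: B_def)
    qed
    moreover have "M \<union> ?S ` r \<subseteq> Pow pos" using MP by blast
    ultimately obtain q where q: "q \<in> beta_pos" "M \<union> ?S ` r \<subseteq> q"
      using beta_pos_exists[of "M \<union> ?S ` r"] by blast
    have "r \<subseteq> uf_plus q p"
    proof
      fix B assume "B \<in> r"
      then show "B \<in> uf_plus q p" using q(2) beta_pos_subset[OF rb] by (auto simp: plus_p)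
    qed
    then have "r = uf_plus q p" using beta_pos_eqI[OF rb uf_plus_beta_pos[OF q(1) pb]] by blast
    then show ?thesis using q by (auto simp: uf_closed_def)
  qed
  have E_I: "uf_plus q p \<in> uf_closed E" if "q \<in> uf_closed M" for q
  proof -
    have "M \<subseteq> uf_plus q p" "uf_plus q p \<in> beta_pos"
      using plus[OF that p] by (auto simp: uf_closed_def)
    moreover have "B \<in> uf_plus q p" if "B \<in> E - M" for B
      using that \<open>q \<in> uf_closed M\<close> unfolding plus_p E_def by blast
    ultimately show ?thesis unfolding uf_closed_def by blast
  qed
  have "uf_closed E \<subseteq> uf_closed M" by (auto simp: uf_closed_def E_def)
  moreover have "E \<subseteq> Pow pos" using MP by (auto simp: E_def)
  ultimately have "semigroup_family E"
    unfolding semigroup_family_def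
    using E_I[OF p] E_D E_I plus p by (metis empty_iff subset_iff uf_plus_assoc)
  \<comment> \<open>By minimality the translate is the whole closed semigroup; in particular
    \<open>p\<close> is itself of the form \<open>uf_plus q p\<close>.\<close>
  then have "E = M" by (rule max) (simp add: E_def)
  then obtain q where q: "q \<in> uf_closed M" "p = uf_plus q p" using E_D p by blast
  \<comment> \<open>The solutions \<open>q\<close> of \<open>uf_plus q p = p\<close> form a nonempty
    closed subsemigroup. By minimality it is everything, so \<open>p\<close> is one of the
    solutions.\<close>
  define L where "L = M \<union> ?S ` p"
  have L: "q \<in> uf_closed L \<longleftrightarrow> q \<in> uf_closed M \<and> uf_plus q p = p" for q
  proof
    assume "q \<in> uf_closed L"
    then have q: "q \<in> uf_closed M" "?S ` p \<subseteq> q" "q \<in> beta_pos" by (auto simp: uf_closed_def L_def)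
    have "p \<subseteq> uf_plus q p"
    proof
      fix B assume "B \<in> p"
      then show "B \<in> uf_plus q p" using q(2) beta_pos_subset[OF pb] by (auto simp: plus_p)
    qed
    then show "q \<in> uf_closed M \<and> uf_plus q p = p"
      using beta_pos_eqI[OF pb uf_plus_beta_pos[OF q(3) pb]] q by simp
  next
    assume q: "q \<in> uf_closed M \<and> uf_plus q p = p"
    then have "B \<in> uf_plus q p" if "B \<in> p" for B using that by simp
    then have "?S ` p \<subseteq> q" unfolding plus_p by blast
    then show "q \<in> uf_closed L" using q by (auto simp: uf_closed_def L_def)
  qed
  have "semigroup_family L"
    unfolding semigroup_family_def
  proof (intro conjI ballI)
    show "L \<subseteq> Pow pos" using MP by (auto simp: L_def)
    have "q \<in> uf_closed L" unfolding L using q by simp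
    then show "uf_closed L \<noteq> {}" by blast
    show "uf_plus r s \<in> uf_closed L" if "r \<in> uf_closed L" "s \<in> uf_closed L" for r s
      using that plus by (simp add: L uf_plus_assoc)
  qed
  then have "L = M" by (rule max) (simp add: L_def)
  then have "uf_plus p p = p" using L p by blast
  moreover have "p \<in> uf_closed F" using p \<open>F \<subseteq> M\<close> by (auto simp: uf_closed_def)
  ultimately show thesis using that by blast
qed

section \<open>Sums along chains\<close>

text \<open>The inclusion above \<open>F\<close> is strict and the top \<open>K\<close> is recorded,
  so that a sum starting above \<open>K\<close> can be appended to one ending in
  \<open>K\<close>.\<close>

inductive chain_sum ::
  "((nat \<Rightarrow> nat) set \<Rightarrow> (nat \<Rightarrow> nat) \<Rightarrow> nat) \<Rightarrow> (nat \<Rightarrow> nat) set \<Rightarrow> (nat \<Rightarrow> nat) set \<Rightarrow> nat \<Rightarrow> bool"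
  for v F where
  single: "K \<in> Pf pos_funs \<Longrightarrow> F \<subset> K \<Longrightarrow> f \<in> K \<Longrightarrow> chain_sum v F K (v K f)"
| step: "chain_sum v F K y \<Longrightarrow> K' \<in> Pf pos_funs \<Longrightarrow> K \<subset> K' \<Longrightarrow> f \<in> K' \<Longrightarrow>
    chain_sum v F K' (y + v K' f)"

definition chain_sums ::
  "((nat \<Rightarrow> nat) set \<Rightarrow> (nat \<Rightarrow> nat) \<Rightarrow> nat) \<Rightarrow> (nat \<Rightarrow> nat) set \<Rightarrow> nat set" where
  "chain_sums v F = {y. \<exists>K. chain_sum v F K y}"

lemma chain_sum_top: "chain_sum v F K y \<Longrightarrow> K \<in> Pf pos_funs"
  by (induction rule: chain_sum.induct) auto

lemma chain_sum_antimono: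
  assumes "chain_sum v F K y" "E \<subseteq> F"
  shows "chain_sum v E K y"
  using assms
proof (induction rule: chain_sum.induct)
  case (single K f)
  then have "E \<subset> K" by blast
  then show ?case using single by (intro chain_sum.single)
next
  case (step K y K' f)
  then show ?case by (intro chain_sum.step)
qed

lemma chain_sums_antimono: "E \<subseteq> F \<Longrightarrow> chain_sums v F \<subseteq> chain_sums v E"
  unfolding chain_sums_def using chain_sum_antimono by blast

lemma chain_sum_append:
  assumes "chain_sum v K L y" "chain_sum v F K x"
  shows "chain_sum v F L (x + y)"
  using assms
proof (induction rule: chain_sum.induct)
  case (single L f)
  then show ?case by (intro chain_sum.step)
next
  case (step L y L' f)
  then have "chain_sum v F L' (x + y + v L' f)" by (intro chain_sum.step) auto
  then show ?case by (simp add: add.assoc)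
qed

text \<open>This is why no chain ever gets stuck: every finite set of functions has a finite proper
  superset.\<close>

lemma infinite_pos_funs: "infinite pos_funs"
proof -
  have "inj (\<lambda>c :: nat. \<lambda>t\<in>pos. Suc c)"
  proof (rule injI)
    fix c d :: nat
    assume "(\<lambda>t\<in>pos. Suc c) = (\<lambda>t\<in>pos. Suc d)"
    then show "c = d" by (auto dest!: fun_cong[of _ _ 1] simp: pos_iff)
  qed
  moreover have "range (\<lambda>c :: nat. \<lambda>t\<in>pos. Suc c) \<subseteq> pos_funs"
    by (auto simp: pos_iff intro!: restrict_in_pos_funs)
  ultimately show ?thesis using infinite_iff_countable_subset by blast
qed

lemma Pf_Un: "F \<in> Pf X \<Longrightarrow> G \<in> Pf X \<Longrightarrow> F \<union> G \<in> Pf X"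
  by (auto simp: Pf_def)

lemma Pf_pos_funs_extend:
  assumes "F \<in> Pf pos_funs"
  obtains K where "K \<in> Pf pos_funs" "F \<subset> K"
proof -
  have "pos_funs - F \<noteq> {}"
    using assms infinite_pos_funs finite_subset[of pos_funs F] by (auto simp: Pf_def)
  then obtain g where "g \<in> pos_funs" "g \<notin> F" by blast
  then have "insert g F \<in> Pf pos_funs" "F \<subset> insert g F" using assms by (auto simp: Pf_def)
  then show thesis by (rule that)
qed

lemma Pf_pos_funs_exists: obtains F where "F \<in> Pf pos_funs"
proof -
  obtain f where "f \<in> pos_funs" using infinite_pos_funs by fastforce
  then have "{f} \<in> Pf pos_funs" by (simp add: Pf_def)
  then show thesis by (rule that)
qed

text \<open>The shift is absorbed into the constant \<open>a\<close>. Contrapositively, no shift of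
  a set that is not a J-set is a J-set, so the complement of such a set lies in
  \<open>uf_plus p q\<close> whenever \<open>q\<close> is in J.\<close>

lemma J_set_shift: "J_set (shift x A) \<Longrightarrow> A \<subseteq> pos \<Longrightarrow> J_set A"
  unfolding J_set_def
proof (intro conjI ballI)
  fix F assume J: "shift x A \<subseteq> pos \<and> (\<forall>F\<in>Pf pos_funs. \<exists>a\<in>pos. \<exists>\<beta>\<in>Pf pos. \<forall>f\<in>F. a + sum f \<beta> \<in> shift x A)"
    and "F \<in> Pf pos_funs"
  then obtain a \<beta> where a: "a \<in> pos" "\<beta> \<in> Pf pos" "\<forall>f\<in>F. a + sum f \<beta> \<in> shift x A" by meson
  then have "x + a \<in> pos" "\<forall>f\<in>F. (x + a) + sum f \<beta> \<in> A" by (simp_all add: shift_def add.assoc)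
  then show "\<exists>a\<in>pos. \<exists>\<beta>\<in>Pf pos. \<forall>f\<in>F. a + sum f \<beta> \<in> A" using a(2) by blast
qed

lemma J_ultrafilter_exists:
  assumes "F \<subseteq> Pow pos" "\<And>G. finite G \<Longrightarrow> G \<subseteq> F \<Longrightarrow> J_set (pos \<inter> \<Inter>G)"
  obtains p where "p \<in> J_ultrafilters" "F \<subseteq> p"
proof (rule ultrafilter_extending[of J_set pos F])
  show "J_set B" if "J_set A" "A \<subseteq> B" "B \<subseteq> pos" for A B using that by (rule J_set_mono)
  show "J_set A \<or> J_set B" if "J_set (A \<union> B)" for A B using that by (rule J_set_Un)
  show "\<not> J_set {}" by (rule not_J_set_empty)
  show "F \<subseteq> Pow pos" by fact
  show "J_set (pos \<inter> \<Inter>G)" if "finite G" "G \<subseteq> F" for G using that by (rule assms)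
  fix p assume "ultrafilter_on pos p" "F \<subseteq> p" "\<And>A. A \<in> p \<Longrightarrow> J_set A"
  then show thesis by (intro that) (auto simp: J_ultrafilters_def beta_pos_def)
qed

lemma idempotent_of_chain_sums:
  assumes \<alpha>: "\<alpha> \<in> Pf pos_funs \<rightarrow> pos" and H: "H \<in> Pf pos_funs \<rightarrow> Pf pos"
    and v: "v = (\<lambda>K f. \<alpha> K + sum f (H K))"
  obtains p where "p \<in> J_ultrafilters" "uf_plus p p = p"
    "\<forall>F\<in>Pf pos_funs. chain_sums v F \<in> p"
proof -
  have vpos: "v K f \<in> pos" if "K \<in> Pf pos_funs" for K f
    using \<alpha> that by (auto simp: v pos_iff Pi_def)
  have "y \<in> pos" if "chain_sum v F K y" for F K y
    using that by (induction rule: chain_sum.induct) (auto simp: vpos)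
  then have sub: "chain_sums v F \<subseteq> pos" for F by (auto simp: chain_sums_def)
  \<comment> \<open>Chains with a single term suffice: for \<open>K\<close> above \<open>F\<close>
    and \<open>G\<close> the one pair \<open>\<alpha> K\<close>, \<open>H K\<close> serves all
    \<open>f \<in> G\<close>.\<close>
  have J: "J_set (chain_sums v F)" if F: "F \<in> Pf pos_funs" for F
    unfolding J_set_def
  proof (intro conjI ballI)
    fix G assume G: "G \<in> Pf pos_funs"
    obtain K where K: "K \<in> Pf pos_funs" "F \<union> G \<subset> K" using Pf_pos_funs_extend[OF Pf_Un[OF F G]] .
    have "\<alpha> K + sum f (H K) \<in> chain_sums v F" if "f \<in> G" for f
      using chain_sum.single[of K F f v] K that by (auto simp: chain_sums_def v)
    then show "\<exists>a\<in>pos. \<exists>\<beta>\<in>Pf pos. \<forall>f\<in>G. a + sum f \<beta> \<in> chain_sums v F"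
      using \<alpha> H K(1) by blast
  qed (fact sub)
  define S where "S = chain_sums v ` Pf pos_funs"
  \<comment> \<open>Containing the complements of all sets that are not J-sets expresses membership
    in J as a closed condition.\<close>
  define E where "E = S \<union> {pos - B |B. B \<subseteq> pos \<and> \<not> J_set B}"
  have fip: "J_set (pos \<inter> \<Inter>G)" if G: "finite G" "G \<subseteq> S" for G
  proof -
    obtain D where D: "D \<subseteq> Pf pos_funs" "finite D" "G = chain_sums v ` D"
      using G finite_subset_image[of G "chain_sums v" "Pf pos_funs"] by (auto simp: S_def)
    \<comment> \<open>\<open>D\<close> may be empty; \<open>F0\<close> keeps the union below
      nonempty.\<close>
    obtain F0 where F0: "F0 \<in> Pf pos_funs" by (rule Pf_pos_funs_exists)
    have F1: "F0 \<union> \<Union>D \<in> Pf pos_funs" using D F0 by (auto simp: Pf_def)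
    have "chain_sums v (F0 \<union> \<Union>D) \<subseteq> chain_sums v F" if "F \<in> D" for F
      using that by (intro chain_sums_antimono) blast
    then show ?thesis using sub D(3) by (intro J_set_mono[OF J[OF F1]]) auto
  qed
  have "S \<subseteq> Pow pos" using sub by (auto simp: S_def)
  then obtain p0 where p0: "p0 \<in> J_ultrafilters" "S \<subseteq> p0" by (rule J_ultrafilter_exists[OF _ fip])
  then have "p0 \<in> beta_pos" by (simp add: J_ultrafilters_def)
  then have "p0 \<in> uf_closed E"
    using p0 beta_pos_compl[of p0] by (auto simp: uf_closed_def E_def J_ultrafilters_def)
  moreover have "uf_plus p q \<in> uf_closed E" if p: "p \<in> uf_closed E" and q: "q \<in> uf_closed E" for p q
  proof -
    have pb: "p \<in> beta_pos" "q \<in> beta_pos" using p q by (auto simp: uf_closed_def)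
    have "chain_sums v F \<in> uf_plus p q" if F: "F \<in> Pf pos_funs" for F
    proof -
      have "shift x (chain_sums v F) \<in> q" if x: "x \<in> chain_sums v F" for x
      proof -
        obtain K where K: "chain_sum v F K x" using x by (auto simp: chain_sums_def)
        have "chain_sums v K \<in> q"
          using q chain_sum_top[OF K] by (auto simp: uf_closed_def E_def S_def)
        moreover have "chain_sums v K \<subseteq> shift x (chain_sums v F)"
          using chain_sum_append[OF _ K] sub[of K] by (auto simp: chain_sums_def shift_def)
        ultimately show ?thesis using beta_pos_mono[OF pb(2) _ _ shift_subset] by blast
      qed
      then have "chain_sums v F \<subseteq> {x \<in> pos. shift x (chain_sums v F) \<in> q}" using sub by blast
      moreover have "chain_sums v F \<in> p" using p F by (auto simp: uf_closed_def E_def S_def)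
      ultimately show ?thesis using beta_pos_mono[OF pb(1)] sub by (simp add: uf_plus_def)
    qed
    moreover have "pos - B \<in> uf_plus p q" if B: "B \<subseteq> pos" "\<not> J_set B" for B
    proof -
      have "pos - shift x B \<in> q" for x
      proof -
        have "\<not> J_set (shift x B)" using B J_set_shift by blast
        then have "pos - shift x B \<in> E" using shift_subset[of x B] by (auto simp: E_def)
        then show ?thesis using q by (auto simp: uf_closed_def)
      qed
      then show ?thesis using beta_pos_pos[OF pb(1)] by (simp add: uf_plus_def shift_compl)
    qed
    ultimately show ?thesis
      using uf_plus_beta_pos[OF pb] by (auto simp: uf_closed_def E_def S_def)
  qed
  moreover have "E \<subseteq> Pow pos" using \<open>S \<subseteq> Pow pos\<close> by (auto simp: E_def)
  ultimately have "semigroup_family E" by (auto simp: semigroup_family_def)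
  then obtain p where p: "p \<in> uf_closed E" "uf_plus p p = p"
    by (rule idempotent_in_closed_subsemigroup)
  then have pb: "p \<in> beta_pos" by (simp add: uf_closed_def)
  have "J_set A" if "A \<in> p" for A
  proof (rule ccontr)
    assume "\<not> J_set A"
    then have "pos - A \<in> p"
      using p(1) beta_pos_subset[OF pb that] by (auto simp: uf_closed_def E_def)
    then show False using beta_pos_compl[OF pb beta_pos_subset[OF pb that]] that by blast
  qed
  then have "p \<in> J_ultrafilters" using pb by (simp add: J_ultrafilters_def)
  moreover have "chain_sums v F \<in> p" if "F \<in> Pf pos_funs" for F
    using p(1) that by (auto simp: uf_closed_def E_def S_def)
  ultimately show thesis using p(2) that by blast
qed

section \<open>Sections of a set along a tensor product\<close>

text \<open>These are the \<open>k\<close>-tuples that reach \<open>A\<close> when \<open>d\<close>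
  further coordinates are chosen one after another along
  \<open>p (k + 1), \<dots>, p (k + d)\<close>. The recursion of \<open>tensor\<close> peels off the
  last coordinate, while both directions of the proof fill the tuple from the first.\<close>

fun tail_section :: "(nat \<Rightarrow> nat set set) \<Rightarrow> (nat \<Rightarrow> nat) set \<Rightarrow> nat \<Rightarrow> nat \<Rightarrow> (nat \<Rightarrow> nat) set" where
  "tail_section p A k 0 = A"
| "tail_section p A k (Suc d) =
     {x \<in> pos_tuples k. {y \<in> pos. x(Suc k := y) \<in> tail_section p A (Suc k) d} \<in> p (Suc k)}"

lemma tail_section_subset: "A \<subseteq> pos_tuples (k + d) \<Longrightarrow> tail_section p A k d \<subseteq> pos_tuples k"
  by (cases d) auto

lemma tensor_iff_tail_section:
  assumes "A \<subseteq> pos_tuples (Suc k + d)"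
  shows "A \<in> tensor p (Suc k + d) \<longleftrightarrow> tail_section p A (Suc k) d \<in> tensor p (Suc k)"
  using assms
proof (induction d arbitrary: k)
  case (Suc d)
  have "tail_section p A (Suc (Suc k)) d \<subseteq> pos_tuples (Suc (Suc k))"
    using Suc.prems by (intro tail_section_subset) simp
  then show ?case using Suc.IH[of "Suc k"] Suc.prems by simp
qed simp

text \<open>Going one level below the base case of \<open>tensor\<close> makes all steps uniform:
  the empty tuple \<open>\<lambda>_. undefined\<close> lies in \<open>L 0\<close>, and each step
  from \<open>L k\<close> to \<open>L (Suc k)\<close> is governed by
  \<open>p (Suc k)\<close>.\<close>

lemma tensor_sections:
  assumes "m \<ge> 1" and A: "A \<subseteq> pos_tuples m"
  obtains L where "L m = A"
    "\<forall>k<m. \<forall>x\<in>pos_tuples k.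
      x \<in> L k \<longleftrightarrow> {y \<in> pos. x(Suc k := y) \<in> L (Suc k)} \<in> p (Suc k)"
    "A \<in> tensor p m \<longleftrightarrow> (\<lambda>_. undefined) \<in> L 0"
proof (rule that[of "\<lambda>k. tail_section p A k (m - k)"])
  let ?L = "\<lambda>k. tail_section p A k (m - k)"
  show "?L m = A" by simp
  have sub: "?L k \<subseteq> pos_tuples k" if "k \<le> m" for k
    using A that by (intro tail_section_subset) simp
  have L: "x \<in> ?L k \<longleftrightarrow> {y \<in> pos. x(Suc k := y) \<in> ?L (Suc k)} \<in> p (Suc k)"
    if "k < m" "x \<in> pos_tuples k" for k x
  proof -
    have "m - k = Suc (m - Suc k)" using that by simp
    then show ?thesis using that by simp
  qed
  then show "\<forall>k<m. \<forall>x\<in>pos_tuples k.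
      x \<in> ?L k \<longleftrightarrow> {y \<in> pos. x(Suc k := y) \<in> ?L (Suc k)} \<in> p (Suc k)"
    by blast
  have "(\<lambda>i\<in>{1}. y) = (\<lambda>_. undefined)(Suc 0 := y)" for y :: nat
    by (auto simp: restrict_def)
  moreover have "(\<lambda>_. undefined) \<in> pos_tuples 0" by (simp add: pos_tuples_def)
  moreover have "A \<in> tensor p m \<longleftrightarrow> ?L 1 \<in> tensor p (Suc 0)"
    using tensor_iff_tail_section[of A 0 "m - 1" p] assms by simp
  ultimately show "A \<in> tensor p m \<longleftrightarrow> (\<lambda>_. undefined) \<in> ?L 0"
    using L[of 0 "\<lambda>_. undefined"] sub[of 1] \<open>m \<ge> 1\<close> by simp
qed

section \<open>From block sums to idempotents\<close>

text \<open>Blocks use the indices from 1 on. The set \<open>G 0\<close> carries no function; it is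
  the bound above which the first block starts.\<close>

definition finite_chain :: "nat \<Rightarrow> (nat \<Rightarrow> (nat \<Rightarrow> nat) set) \<Rightarrow> (nat \<Rightarrow> nat \<Rightarrow> nat) \<Rightarrow> bool" where
  "finite_chain n G f \<longleftrightarrow> (\<forall>i\<le>n. G i \<in> Pf pos_funs) \<and> (\<forall>i<n. G i \<subset> G (Suc i)) \<and>
     (\<forall>i\<in>{1..n}. f i \<in> G i)"

definition blocks :: "nat \<Rightarrow> nat \<Rightarrow> (nat \<Rightarrow> nat set) \<Rightarrow> bool" where
  "blocks k n \<beta> \<longleftrightarrow> (\<forall>j\<in>{1..k}. \<beta> j \<subseteq> {1..n} \<and> \<beta> j \<noteq> {}) \<and>
     (\<forall>j\<in>{1..<k}. block_less (\<beta> j) (\<beta> (Suc j)))"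

definition block_tuple ::
  "(nat \<Rightarrow> (nat \<Rightarrow> nat) set \<Rightarrow> (nat \<Rightarrow> nat) \<Rightarrow> nat) \<Rightarrow> nat \<Rightarrow> (nat \<Rightarrow> (nat \<Rightarrow> nat) set) \<Rightarrow>
   (nat \<Rightarrow> nat \<Rightarrow> nat) \<Rightarrow> (nat \<Rightarrow> nat set) \<Rightarrow> nat \<Rightarrow> nat" where
  "block_tuple v k G f \<beta> = (\<lambda>j\<in>{1..k}. \<Sum>i\<in>\<beta> j. v j (G i) (f i))"

lemma blocksD:
  assumes "blocks k n \<beta>" "j \<in> {1..k}"
  shows "\<beta> j \<subseteq> {1..n}" "\<beta> j \<noteq> {}" "finite (\<beta> j)"
proof -
  show "\<beta> j \<subseteq> {1..n}" "\<beta> j \<noteq> {}" using assms unfolding blocks_def by blast+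
  then show "finite (\<beta> j)" using finite_subset by blast
qed

lemma block_tuple_Suc:
  "block_tuple v (Suc k) G f \<beta> = (block_tuple v k G f \<beta>)(Suc k := \<Sum>i\<in>\<beta> (Suc k). v (Suc k) (G i) (f i))"
  by (auto simp: block_tuple_def restrict_def)

lemma block_tuple_cong:
  assumes "blocks k n \<beta>" "\<And>j. j \<in> {1..k} \<Longrightarrow> \<beta>' j = \<beta> j"
    "\<And>i. i \<in> {1..n} \<Longrightarrow> G' i = G i" "\<And>i. i \<in> {1..n} \<Longrightarrow> f' i = f i"
  shows "block_tuple v k G' f' \<beta>' = block_tuple v k G f \<beta>"
  unfolding block_tuple_def
proof (rule restrict_ext, rule sum.cong)
  fix j i assume j: "j \<in> {1..k}"
  then show "\<beta>' j = \<beta> j" by (rule assms)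
  assume "i \<in> \<beta> j"
  then have "i \<in> {1..n}" using blocksD(1)[OF assms(1) j] by blast
  then show "v j (G' i) (f' i) = v j (G i) (f i)" using assms by simp
qed

lemma finite_chain_extend:
  assumes "finite_chain n G f" "K \<in> Pf pos_funs" "G n \<subset> K" "g \<in> K"
  shows "finite_chain (Suc n) (G(Suc n := K)) (f(Suc n := g))"
  using assms by (auto simp: finite_chain_def le_Suc_eq less_Suc_eq)

lemma blocks_extend:
  assumes b: "blocks k n \<beta>" and B: "B \<subseteq> {1..n'}" "B \<noteq> {}" "n \<le> n'"
    and less: "k \<ge> 1 \<Longrightarrow> block_less (\<beta> k) B"
  shows "blocks (Suc k) n' (\<beta>(Suc k := B))"
  unfolding blocks_def
proof (intro conjI ballI)
  fix j assume j: "j \<in> {1..Suc k}"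
  have "(\<beta>(Suc k := B)) j \<subseteq> {1..n'} \<and> (\<beta>(Suc k := B)) j \<noteq> {}"
  proof (cases "j = Suc k")
    case False
    then have "\<beta> j \<subseteq> {1..n}" "\<beta> j \<noteq> {}" using blocksD[OF b, of j] j by simp_all
    moreover have "{1..n} \<subseteq> {1..n'}" using B(3) by simp
    ultimately show ?thesis using False by auto
  qed (use B in simp)
  then show "(\<beta>(Suc k := B)) j \<subseteq> {1..n'}" "(\<beta>(Suc k := B)) j \<noteq> {}" by simp_all
next
  fix j assume "j \<in> {1..<Suc k}"
  then show "block_less ((\<beta>(Suc k := B)) j) ((\<beta>(Suc k := B)) (Suc j))"
    using b less by (cases "j = k") (auto simp: blocks_def)
qed

text \<open>Induction along the chain sum: its first set opens block \<open>Suc k\<close> at index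
  \<open>Suc n\<close>, and each later one is appended both to the chain and to that block. The
  clause \<open>G' n' = K\<close> allows the next set to be appended.\<close>

lemma block_tuple_chain_sum:
  assumes "chain_sum (v (Suc k)) (G n) K y" "finite_chain n G f" "blocks k n \<beta>"
  shows "\<exists>n' G' f' \<beta>'. finite_chain n' G' f' \<and> blocks (Suc k) n' \<beta>' \<and> G' n' = K \<and>
    block_tuple v (Suc k) G' f' \<beta>' = (block_tuple v k G f \<beta>)(Suc k := y)"
  using assms(1)
proof (induction rule: chain_sum.induct)
  case (single K g)
  let ?G = "G(Suc n := K)" and ?f = "f(Suc n := g)" and ?\<beta> = "\<beta>(Suc k := {Suc n})"
  have "finite_chain (Suc n) ?G ?f" using assms(2) single by (intro finite_chain_extend)
  moreover have "blocks (Suc k) (Suc n) ?\<beta>"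
  proof (rule blocks_extend[OF assms(3)])
    assume "k \<ge> 1"
    then have "\<beta> k \<subseteq> {1..n}" "\<beta> k \<noteq> {}" "finite (\<beta> k)"
      using blocksD[OF assms(3), of k] by simp_all
    then have "Max (\<beta> k) \<in> {1..n}" using Max_in by blast
    then show "block_less (\<beta> k) {Suc n}" by (simp add: block_less_def)
  qed auto
  moreover have "block_tuple v k ?G ?f ?\<beta> = block_tuple v k G f \<beta>"
    by (rule block_tuple_cong[OF assms(3)]) auto
  then have "block_tuple v (Suc k) ?G ?f ?\<beta> = (block_tuple v k G f \<beta>)(Suc k := v (Suc k) K g)"
    by (simp add: block_tuple_Suc)
  ultimately show ?case by (intro exI[of _ "Suc n"] exI[of _ ?G] exI[of _ ?f] exI[of _ ?\<beta>] conjI)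
      (assumption | rule fun_upd_same)+
next
  case (step K y K' g)
  then obtain n1 G1 f1 \<beta>1 where 1: "finite_chain n1 G1 f1" "blocks (Suc k) n1 \<beta>1" "G1 n1 = K"
    "block_tuple v (Suc k) G1 f1 \<beta>1 = (block_tuple v k G f \<beta>)(Suc k := y)"
    by blast
  let ?B = "insert (Suc n1) (\<beta>1 (Suc k))"
  let ?G = "G1(Suc n1 := K')" and ?f = "f1(Suc n1 := g)" and ?\<beta> = "\<beta>1(Suc k := ?B)"
  have B: "\<beta>1 (Suc k) \<subseteq> {1..n1}" "\<beta>1 (Suc k) \<noteq> {}" "finite (\<beta>1 (Suc k))"
    using blocksD[OF 1(2), of "Suc k"] by simp_all
  have b1: "blocks k n1 \<beta>1" using 1(2) by (auto simp: blocks_def)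
  have "finite_chain (Suc n1) ?G ?f" using 1 step by (intro finite_chain_extend) auto
  moreover have "blocks (Suc k) (Suc n1) ?\<beta>"
  proof (rule blocks_extend[OF b1])
    assume "k \<ge> 1"
    \<comment> \<open>The appended index exceeds the whole block, so the minimum and with it the
      order relative to block \<open>k\<close> are unchanged.\<close>
    have "Min (\<beta>1 (Suc k)) \<in> {1..n1}" using B Min_in by blast
    then have "Min ?B = Min (\<beta>1 (Suc k))" using B by simp
    then show "block_less (\<beta>1 k) ?B" using 1(2) \<open>k \<ge> 1\<close> by (auto simp: blocks_def block_less_def)
  qed (use B in auto)
  moreover have "block_tuple v (Suc k) ?G ?f ?\<beta> = (block_tuple v k G f \<beta>)(Suc k := y + v (Suc k) K' g)"
  proof -
    have t: "block_tuple v (Suc k) ?G ?f \<beta>1 = (block_tuple v k G f \<beta>)(Suc k := y)"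
      unfolding 1(4)[symmetric] by (rule block_tuple_cong[OF 1(2)]) auto
    have "block_tuple v k ?G ?f ?\<beta> = block_tuple v k ?G ?f \<beta>1"
      by (rule block_tuple_cong[OF b1]) auto
    moreover have "Suc n1 \<notin> \<beta>1 (Suc k)" using B by auto
    ultimately have "block_tuple v (Suc k) ?G ?f ?\<beta>
        = (block_tuple v (Suc k) ?G ?f \<beta>1)(Suc k := v (Suc k) K' g + block_tuple v (Suc k) ?G ?f \<beta>1 (Suc k))"
      using B by (simp add: block_tuple_Suc)
    then show ?thesis unfolding t by (simp add: add.commute)
  qed
  ultimately show ?case by (intro exI[of _ "Suc n1"] exI[of _ ?G] exI[of _ ?f] exI[of _ ?\<beta>] conjI)
      (assumption | rule fun_upd_same)+
qed

text \<open>Condition (b) speaks of infinite sequences only, so a finite chain must be prolonged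
  before (b) applies; the blocks do not see the added terms.\<close>

lemma finite_chain_continue:
  assumes "finite_chain n G f"
  obtains G' f' where "\<forall>i. G' i \<in> Pf pos_funs" "\<forall>i. G' i \<subset> G' (Suc i)" "\<forall>i\<in>pos. f' i \<in> G' i"
    "\<forall>i\<in>{1..n}. G' i = G i" "\<forall>i\<in>{1..n}. f' i = f i"
proof -
  have "\<forall>F\<in>Pf pos_funs. \<exists>K. K \<in> Pf pos_funs \<and> F \<subset> K" using Pf_pos_funs_extend by metis
  then obtain \<sigma> where \<sigma>: "\<And>F. F \<in> Pf pos_funs \<Longrightarrow> \<sigma> F \<in> Pf pos_funs" "\<And>F. F \<in> Pf pos_funs \<Longrightarrow> F \<subset> \<sigma> F"
    by metis
  \<comment> \<open>For \<open>i \<le> n\<close> the truncated difference is 0 and the value is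
    \<open>G i\<close>; beyond \<open>n\<close> the successor \<open>\<sigma>\<close> is iterated on
    \<open>G n\<close>.\<close>
  define G' where "G' = (\<lambda>i. (\<sigma> ^^ (i - n)) (G (min i n)))"
  define f' where "f' = (\<lambda>i. if i \<le> n then f i else SOME g. g \<in> G' i)"
  have iter: "(\<sigma> ^^ d) F \<in> Pf pos_funs" if "F \<in> Pf pos_funs" for d F
    using that by (induction d) (auto simp: \<sigma>)
  have G'Pf: "G' i \<in> Pf pos_funs" for i
    unfolding G'_def using assms by (intro iter) (auto simp: finite_chain_def)
  moreover have "G' i \<subset> G' (Suc i)" for i
  proof (cases "i < n")
    case True
    then show ?thesis using assms by (simp add: G'_def finite_chain_def)
  next
    case False
    then have "G' (Suc i) = \<sigma> (G' i)" by (simp add: G'_def Suc_diff_le)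
    then show ?thesis using \<sigma>(2)[OF G'Pf] by simp
  qed
  moreover have "f' i \<in> G' i" if "i \<in> pos" for i
  proof (cases "i \<le> n")
    case True
    then show ?thesis using that assms by (auto simp: f'_def G'_def finite_chain_def pos_iff)
  next
    case False
    have "G' i \<noteq> {}" using G'Pf[of i] by (simp add: Pf_def)
    then show ?thesis using False by (simp add: f'_def some_in_eq)
  qed
  ultimately show thesis using that[of G' f'] by (simp add: G'_def f'_def)
qed

text \<open>Induction on the number \<open>d\<close> of missing coordinates shows that every
  \<open>k\<close>-tuple of block sums on a finite chain lies in \<open>L k\<close>. For
  \<open>d = 0\<close> this is \<open>in_A\<close>; in the step all chain sums above the top
  \<open>G n\<close> are admissible next coordinates, and they form a member of
  \<open>p (Suc k)\<close>.\<close>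

lemma tensor_of_block_tuples:
  assumes "m \<ge> 1" and A: "A \<subseteq> pos_tuples m"
    and p: "\<And>j. j \<in> {1..m} \<Longrightarrow> p j \<in> beta_pos"
    and T: "\<And>j F. j \<in> {1..m} \<Longrightarrow> F \<in> Pf pos_funs \<Longrightarrow> chain_sums (v j) F \<in> p j"
    and vpos: "\<And>j K f. j \<in> {1..m} \<Longrightarrow> K \<in> Pf pos_funs \<Longrightarrow> v j K f \<in> pos"
    and in_A: "\<And>G f \<beta>. (\<And>i. i \<in> pos \<Longrightarrow> G i \<in> Pf pos_funs) \<Longrightarrow> (\<And>i. i \<in> pos \<Longrightarrow> G i \<subset> G (Suc i)) \<Longrightarrow>
      (\<And>j. j \<in> {1..m} \<Longrightarrow> \<beta> j \<in> Pf pos) \<Longrightarrow>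
      (\<And>j. j \<in> {1..<m} \<Longrightarrow> block_less (\<beta> j) (\<beta> (Suc j))) \<Longrightarrow>
      (\<And>i. i \<in> pos \<Longrightarrow> f i \<in> G i) \<Longrightarrow> block_tuple v m G f \<beta> \<in> A"
  shows "A \<in> tensor p m"
proof -
  obtain L where L: "L m = A" "\<forall>k<m. \<forall>x\<in>pos_tuples k.
      x \<in> L k \<longleftrightarrow> {y \<in> pos. x(Suc k := y) \<in> L (Suc k)} \<in> p (Suc k)"
    "A \<in> tensor p m \<longleftrightarrow> (\<lambda>_. undefined) \<in> L 0"
    by (rule tensor_sections[OF assms(1,2), where p = p])
  have "block_tuple v k G f \<beta> \<in> L k"
    if "k + d = m" "finite_chain n G f" "blocks k n \<beta>" for k d n G f \<beta>
    using that
  proof (induction d arbitrary: k n G f \<beta>)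
    case 0
    obtain G' f' where G': "\<forall>i. G' i \<in> Pf pos_funs" "\<forall>i. G' i \<subset> G' (Suc i)"
      "\<forall>i\<in>pos. f' i \<in> G' i" "\<forall>i\<in>{1..n}. G' i = G i" "\<forall>i\<in>{1..n}. f' i = f i"
      by (rule finite_chain_continue[OF "0.prems"(2)])
    have b: "blocks m n \<beta>" using 0 by simp
    have "\<beta> j \<in> Pf pos" if "j \<in> {1..m}" for j
      using blocksD[OF b that] by (auto simp: Pf_def pos_def)
    moreover have "block_less (\<beta> j) (\<beta> (Suc j))" if "j \<in> {1..<m}" for j
      using b that by (auto simp: blocks_def)
    ultimately have "block_tuple v m G' f' \<beta> \<in> A"
      using G' by (intro in_A) blast+
    moreover have "block_tuple v m G' f' \<beta> = block_tuple v m G f \<beta>"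
      using b G' by (intro block_tuple_cong) auto
    ultimately show ?case using 0 L(1) by simp
  next
    case (Suc d)
    let ?x = "block_tuple v k G f \<beta>"
    have x: "?x \<in> pos_tuples k"
      unfolding block_tuple_def pos_tuples_def
    proof (subst restrict_PiE_iff, intro ballI)
      fix j assume j: "j \<in> {1..k}"
      note b = blocksD[OF Suc.prems(3) j]
      obtain i where i: "i \<in> \<beta> j" using b(2) by blast
      have "v j (G i) (f i) \<in> pos"
        using i b j Suc.prems by (intro vpos) (auto simp: finite_chain_def)
      then show "(\<Sum>i\<in>\<beta> j. v j (G i) (f i)) \<in> pos"
        using i b(3) by (auto simp: pos_iff)
    qed
    have k: "Suc k \<in> {1..m}" "k < m" using Suc.prems by auto
    have sums: "chain_sums (v (Suc k)) (G n) \<in> p (Suc k)"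
      using k Suc.prems(2) by (intro T) (auto simp: finite_chain_def)
    have "chain_sums (v (Suc k)) (G n) \<subseteq> {y \<in> pos. ?x(Suc k := y) \<in> L (Suc k)}"
    proof
      fix y assume y: "y \<in> chain_sums (v (Suc k)) (G n)"
      then obtain K where K: "chain_sum (v (Suc k)) (G n) K y" by (auto simp: chain_sums_def)
      obtain n' G' f' \<beta>'
        where *: "finite_chain n' G' f'" "blocks (Suc k) n' \<beta>'"
          "block_tuple v (Suc k) G' f' \<beta>' = ?x(Suc k := y)"
        using block_tuple_chain_sum[of v k G n K y f \<beta>, OF K Suc.prems(2,3)] by blast
      have "block_tuple v (Suc k) G' f' \<beta>' \<in> L (Suc k)"
        using Suc.prems(1) by (intro Suc.IH[OF _ *(1,2)]) simp
      then have "?x(Suc k := y) \<in> L (Suc k)" by (simp only: *(3))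
      moreover have "y \<in> pos" using y sums beta_pos_subset[OF p[OF k(1)]] by blast
      ultimately show "y \<in> {y \<in> pos. ?x(Suc k := y) \<in> L (Suc k)}" by simp
    qed
    then have "{y \<in> pos. ?x(Suc k := y) \<in> L (Suc k)} \<in> p (Suc k)"
      using sums beta_pos_mono[OF p[OF k(1)]] by blast
    then show ?case using L(2)[rule_format, OF k(2) x] by simp
  qed
  moreover obtain F0 where "F0 \<in> Pf pos_funs" by (rule Pf_pos_funs_exists)
  then have "finite_chain 0 (\<lambda>_. F0) (\<lambda>_. undefined)" by (simp add: finite_chain_def)
  moreover have "blocks 0 0 (\<lambda>_. {})" by (simp add: blocks_def)
  ultimately have "block_tuple v 0 (\<lambda>_. F0) (\<lambda>_. undefined) (\<lambda>_. {}) \<in> L 0" by (metis add_0)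
  then show ?thesis using L(3) by (simp add: block_tuple_def restrict_def)
qed

section \<open>From idempotents to block sums\<close>

lemma idempotent_star:
  assumes p: "p \<in> beta_pos" "uf_plus p p = p" and E: "E \<in> p"
  shows "{y \<in> E. shift y E \<in> p} \<in> p"
proof -
  have "E \<in> uf_plus p p" using p E by simp
  then have "{x \<in> pos. shift x E \<in> p} \<in> p" by (simp add: uf_plus_def)
  then have "E \<inter> {x \<in> pos. shift x E \<in> p} \<in> p" by (rule beta_pos_Int[OF p(1) E])
  moreover have "E \<inter> {x \<in> pos. shift x E \<in> p} = {y \<in> E. shift y E \<in> p}"
    using beta_pos_subset[OF p(1) E] by blast
  ultimately show ?thesis by simp
qed

text \<open>The previous lemma for \<open>shift z E\<close>: a partial sum that can be extended can
  be extended in such a way that it remains extendable.\<close>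

lemma idempotent_star_shift:
  assumes p: "p \<in> beta_pos" "uf_plus p p = p" and z: "z \<in> pos" "shift z E \<in> p"
  shows "{y \<in> pos. z + y \<in> E \<and> shift (z + y) E \<in> p} \<in> p"
proof -
  have "{y \<in> shift z E. shift y (shift z E) \<in> p} = {y \<in> pos. z + y \<in> E \<and> shift (z + y) E \<in> p}"
    using z by (auto simp: shift_shift) (auto simp: shift_def)
  then show ?thesis using idempotent_star[OF p z(2)] by simp
qed

lemma pos_tuples_upd:
  assumes "x \<in> pos_tuples k" "y \<in> pos"
  shows "x(Suc k := y) \<in> pos_tuples (Suc k)" and "j \<in> {1..k} \<Longrightarrow> x(j := y) \<in> pos_tuples k"
  using assms by (auto simp: pos_tuples_def PiE_iff extensional_def)

section \<open>States of partial tuples and one step of the recursion\<close>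

text \<open>
  A state \<open>(j, x)\<close> records that the blocks \<open>1, \<dots>, j\<close> have been started and have the sums \<open>x\<close>;
  a set \<open>F\<close> of functions may extend the current block or open the next one.
\<close>

definition next_states ::
  "nat \<Rightarrow> (nat \<Rightarrow> (nat \<Rightarrow> nat) \<Rightarrow> nat) \<Rightarrow> (nat \<Rightarrow> nat) set \<Rightarrow> (nat \<times> (nat \<Rightarrow> nat)) set \<Rightarrow>
   (nat \<times> (nat \<Rightarrow> nat)) set" where
  "next_states m w F Y =
     (\<lambda>((j, x), f). (j, x(j := x j + w j f))) ` ({s \<in> Y. fst s \<ge> 1} \<times> F) \<union>
     (\<lambda>((j, x), f). (Suc j, x(Suc j := w (Suc j) f))) ` ({s \<in> Y. fst s < m} \<times> F)"

lemma finite_next_states: "finite Y \<Longrightarrow> finite F \<Longrightarrow> finite (next_states m w F Y)"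
  by (simp add: next_states_def)

lemma next_statesI:
  "(j, x) \<in> Y \<Longrightarrow> j \<ge> 1 \<Longrightarrow> f \<in> F \<Longrightarrow> (j, x(j := x j + w j f)) \<in> next_states m w F Y"
  "(j, x) \<in> Y \<Longrightarrow> j < m \<Longrightarrow> f \<in> F \<Longrightarrow> (Suc j, x(Suc j := w (Suc j) f)) \<in> next_states m w F Y"
  unfolding next_states_def by force+

lemma next_statesE:
  assumes "(k, z) \<in> next_states m w F Y"
  obtains f x where "(k, x) \<in> Y" "k \<ge> 1" "f \<in> F" "z = x(k := x k + w k f)"
  | f x j where "(j, x) \<in> Y" "j < m" "f \<in> F" "k = Suc j" "z = x(Suc j := w (Suc j) f)"
  using assms unfolding next_states_def by fastforce

text \<open>Finitely many states impose finitely many conditions on coordinate \<open>j\<close>,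
  each a member of \<open>p j\<close>. Their intersection is a J-set, so one constant and one block
  beyond \<open>d\<close> satisfy them for all \<open>f \<in> F\<close> together.\<close>

lemma next_block_maps:
  assumes p: "\<And>j. j \<in> {1..m} \<Longrightarrow> p j \<in> J_ultrafilters"
    and open_block: "\<And>j x. j < m \<Longrightarrow> good j x \<Longrightarrow> {z \<in> pos. good (Suc j) (x(Suc j := z))} \<in> p (Suc j)"
    and extend_block: "\<And>j x. j \<in> {1..m} \<Longrightarrow> good j x \<Longrightarrow> {z \<in> pos. good j (x(j := x j + z))} \<in> p j"
    and Y: "finite Y" "\<And>j x. (j, x) \<in> Y \<Longrightarrow> j \<le> m \<and> good j x"
    and F: "F \<in> Pf pos_funs"
  obtains a h where "\<forall>j\<in>{1..m}. a j \<in> pos \<and> h j \<in> Pf pos \<and> d < Min (h j)"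
    "\<forall>(j, x)\<in>next_states m (\<lambda>j f. a j + sum f (h j)) F Y. j \<le> m \<and> good j x"
proof -
  have "\<exists>a b. a \<in> pos \<and> b \<in> Pf pos \<and> d < Min b \<and> (\<forall>f\<in>F.
      (\<forall>x. (j, x) \<in> Y \<longrightarrow> good j (x(j := x j + (a + sum f b)))) \<and>
      (\<forall>i x. (i, x) \<in> Y \<longrightarrow> j = Suc i \<longrightarrow> good j (x(j := a + sum f b))))"
    if j: "j \<in> {1..m}" for j
  proof -
    \<comment> \<open>Coordinate \<open>j\<close> is changed from states at \<open>j\<close>, whose
      block grows, and from states at \<open>j - 1\<close>, which open block
      \<open>j\<close>.\<close>
    define S where "S = (\<lambda>x. {z \<in> pos. good j (x(j := x j + z))}) ` {x. (j, x) \<in> Y} \<union>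
      (\<lambda>x. {z \<in> pos. good j (x(j := z))}) ` {x. (j - 1, x) \<in> Y}"
    have fin: "finite {x. (i, x) \<in> Y}" for i
      by (rule finite_subset[OF _ finite_imageI[OF Y(1), of snd]]) force
    have "finite S" unfolding S_def using fin by simp
    moreover have "{z \<in> pos. good j (x(j := x j + z))} \<in> p j" if "(j, x) \<in> Y" for x
      using extend_block[OF j] Y(2)[OF that] by blast
    moreover have "{z \<in> pos. good j (x(j := z))} \<in> p j" if "(j - 1, x) \<in> Y" for x
    proof -
      have "j - 1 < m" "Suc (j - 1) = j" using j by auto
      then show ?thesis using open_block[of "j - 1" x] Y(2)[OF that] by simp
    qed
    ultimately have "pos \<inter> \<Inter>S \<in> p j"
      using p[OF j] by (intro beta_pos_Inter) (auto simp: J_ultrafilters_def S_def)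
    then have "J_set (pos \<inter> \<Inter>S)" using p[OF j] by (simp add: J_ultrafilters_def)
    from J_set_beyond[OF this F, of d] obtain a b where ab: "a \<in> pos" "b \<in> Pf pos" "d < Min b"
      "\<And>f. f \<in> F \<Longrightarrow> a + sum f b \<in> pos \<inter> \<Inter>S"
      by blast
    have "good j (x(j := x j + (a + sum f b)))" if "f \<in> F" "(j, x) \<in> Y" for f x
    proof -
      have "{z \<in> pos. good j (x(j := x j + z))} \<in> S" using that(2) unfolding S_def by blast
      then show ?thesis using ab(4)[OF that(1)] by blast
    qed
    moreover have "good j (x(j := a + sum f b))" if "f \<in> F" "(i, x) \<in> Y" "j = Suc i" for f i x
    proof -
      have "(j - 1, x) \<in> Y" using that(2,3) by simp
      then have "{z \<in> pos. good j (x(j := z))} \<in> S" unfolding S_def by blast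
      then show ?thesis using ab(4)[OF that(1)] by blast
    qed
    ultimately show ?thesis using ab(1-3) by blast
  qed
  then obtain a h where ah: "\<And>j. j \<in> {1..m} \<Longrightarrow> a j \<in> pos \<and> h j \<in> Pf pos \<and> d < Min (h j)"
    and ext: "\<And>j f x. j \<in> {1..m} \<Longrightarrow> f \<in> F \<Longrightarrow> (j, x) \<in> Y \<Longrightarrow> good j (x(j := x j + (a j + sum f (h j))))"
    and opn: "\<And>j f i x. j \<in> {1..m} \<Longrightarrow> f \<in> F \<Longrightarrow> (i, x) \<in> Y \<Longrightarrow> j = Suc i \<Longrightarrow>
      good j (x(j := a j + sum f (h j)))"
    by metis
  have "j \<le> m \<and> good j z" if "(j, z) \<in> next_states m (\<lambda>j f. a j + sum f (h j)) F Y" for j z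
    using that
  proof (cases rule: next_statesE)
    case (1 f x)
    then show ?thesis using Y(2)[OF 1(1)] ext[of j f x] by simp
  next
    case (2 f x i)
    then show ?thesis using opn[of j f i x] by simp
  qed
  then show thesis using that[of a h] ah by blast
qed

section \<open>The recursion over finite sets of functions\<close>

text \<open>
  A stage \<open>(a, h, X)\<close> at \<open>F\<close> consists of the values \<open>\<alpha>\<^sub>j(F) = a j\<close> and \<open>H\<^sub>j(F) = h j\<close> and of the set
  \<open>X\<close> of all states that chains with top \<open>F\<close> can reach.
\<close>

type_synonym stage = "(nat \<Rightarrow> nat) \<times> (nat \<Rightarrow> nat set) \<times> (nat \<times> (nat \<Rightarrow> nat)) set"

text \<open>Recursion along \<open>finite_psubset\<close> carries the reachable states together with
  the values, since the values at \<open>F\<close> must suit every chain leading to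
  \<open>F\<close>. Following a given sequence, the block sums then pass only through recorded,
  hence good, states.\<close>

lemma block_maps_exist:
  fixes good :: "nat \<Rightarrow> (nat \<Rightarrow> nat) \<Rightarrow> bool"
  assumes "m \<ge> 1"
    and p: "\<And>j. j \<in> {1..m} \<Longrightarrow> p j \<in> J_ultrafilters"
    and good_0: "good 0 (\<lambda>_. undefined)"
    and open_block: "\<And>j x. j < m \<Longrightarrow> good j x \<Longrightarrow> {z \<in> pos. good (Suc j) (x(Suc j := z))} \<in> p (Suc j)"
    and extend_block: "\<And>j x. j \<in> {1..m} \<Longrightarrow> good j x \<Longrightarrow> {z \<in> pos. good j (x(j := x j + z))} \<in> p j"
  obtains \<alpha> H where "\<forall>j\<in>{1..m}. \<alpha> j \<in> Pf pos_funs \<rightarrow> pos \<and> H j \<in> Pf pos_funs \<rightarrow> Pf pos"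
    "\<forall>F\<in>Pf pos_funs. \<forall>K\<in>Pf pos_funs. F \<subset> K \<longrightarrow> (\<forall>j\<in>{1..m}. Max (H j F) < Min (H j K))"
    "\<forall>G \<beta> f. (\<forall>i\<in>pos. G i \<in> Pf pos_funs \<and> G i \<subset> G (Suc i) \<and> f i \<in> G i) \<longrightarrow>
       (\<forall>j\<in>{1..m}. \<beta> j \<in> Pf pos) \<longrightarrow> (\<forall>j\<in>{1..<m}. block_less (\<beta> j) (\<beta> (Suc j))) \<longrightarrow>
       good m (block_tuple (\<lambda>j K g. \<alpha> j K + sum g (H j K)) m G f \<beta>)"
proof -
  define below where "below = (\<lambda>F. {G \<in> Pf pos_funs. G \<subset> F})"
  \<comment> \<open>These are the states from which \<open>F\<close> may continue: the empty tuple,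
    where the first block starts, and everything reached at any proper subset. Admitting all proper
    subsets allows blocks with gaps.\<close>
  define Y where "Y = (\<lambda>(s :: (nat \<Rightarrow> nat) set \<Rightarrow> stage) F.
    insert (0, \<lambda>_. undefined) (\<Union>G\<in>below F. snd (snd (s G))))"
  define P where "P = (\<lambda>s F (a, h, X). F \<in> Pf pos_funs \<longrightarrow>
    X = next_states m (\<lambda>j f. a j + sum f (h j)) F (Y s F) \<and>
    finite X \<and> (\<forall>(j, x)\<in>X. j \<le> m \<and> good j x) \<and>
    (\<forall>j\<in>{1..m}. a j \<in> pos \<and> h j \<in> Pf pos \<and>
      (\<forall>G\<in>below F. Max (fst (snd (s G)) j) < Min (h j))))"
  have finite_below: "finite (below F)" if "F \<in> Pf pos_funs" for F
    by (rule finite_subset[of _ "Pow F"]) (use that in \<open>auto simp: below_def Pf_def\<close>)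
  have below_wf: "(G, F) \<in> finite_psubset" if "F \<in> Pf pos_funs" "G \<in> below F" for F G
    using that by (auto simp: below_def finite_psubset_def Pf_def)
  have Y_good: "finite (Y s F) \<and> (\<forall>(j, x)\<in>Y s F. j \<le> m \<and> good j x)"
    if F: "F \<in> Pf pos_funs" and s: "\<And>G. G \<in> below F \<Longrightarrow> P s G (s G)" for s F
  proof -
    have "finite (snd (snd (s G))) \<and> (\<forall>(j, x)\<in>snd (snd (s G)). j \<le> m \<and> good j x)"
      if "G \<in> below F" for G
      using s[OF that] that by (auto simp: P_def below_def split: prod.splits)
    then show ?thesis using finite_below[OF F] good_0 by (fastforce simp: Y_def)
  qed
  have "\<exists>s. \<forall>F. P s F (s F)"
  proof (rule dependent_wf_choice[OF wf_finite_psubset])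
    fix s s' :: "(nat \<Rightarrow> nat) set \<Rightarrow> stage" and F r
    assume eq: "\<And>G. (G, F) \<in> finite_psubset \<Longrightarrow> s G = s' G"
    show "P s F r = P s' F r"
    proof (cases "F \<in> Pf pos_funs")
      case True
      then have *: "s G = s' G" if "G \<in> below F" for G using that by (intro eq below_wf)
      then have "Y s F = Y s' F" by (simp add: Y_def)
      then show ?thesis using * by (simp add: P_def split: prod.splits cong: conj_cong)
    qed (simp add: P_def split: prod.splits)
  next
    fix F and s :: "(nat \<Rightarrow> nat) set \<Rightarrow> stage"
    assume s: "\<And>G. (G, F) \<in> finite_psubset \<Longrightarrow> P s G (s G)"
    show "\<exists>r. P s F r"
    proof (cases "F \<in> Pf pos_funs")
      case True
      have YF: "finite (Y s F)" "\<And>j x. (j, x) \<in> Y s F \<Longrightarrow> j \<le> m \<and> good j x"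
        using Y_good[OF True, of s] s below_wf[OF True] by blast+
      \<comment> \<open>A sum instead of a maximum, because \<open>below F\<close> is empty for a
        singleton \<open>F\<close>.\<close>
      define d where "d = (\<Sum>(G, j)\<in>below F \<times> {1..m}. Max (fst (snd (s G)) j))"
      have d: "Max (fst (snd (s G)) j) \<le> d" if "G \<in> below F" "j \<in> {1..m}" for G j
        using member_le_sum[of "(G, j)" "below F \<times> {1..m}" "\<lambda>(G, j). Max (fst (snd (s G)) j)"]
          that finite_below[OF True] by (simp add: d_def)
      obtain a h where ah: "\<forall>j\<in>{1..m}. a j \<in> pos \<and> h j \<in> Pf pos \<and> d < Min (h j)"
        "\<forall>(j, x)\<in>next_states m (\<lambda>j f. a j + sum f (h j)) F (Y s F). j \<le> m \<and> good j x"
        by (rule next_block_maps[OF p open_block extend_block YF True])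
      have "finite F" using True by (simp add: Pf_def)
      then have "P s F (a, h, next_states m (\<lambda>j f. a j + sum f (h j)) F (Y s F))"
        using ah YF(1) d by (fastforce simp: P_def intro!: finite_next_states le_less_trans[OF d])
      then show ?thesis ..
    qed (simp add: P_def)
  qed
  then obtain s where s: "\<And>F. P s F (s F)" by blast
  define \<alpha> where "\<alpha> = (\<lambda>j F. fst (s F) j)"
  define H where "H = (\<lambda>j F. fst (snd (s F)) j)"
  define X where "X = (\<lambda>F. snd (snd (s F)))"
  define v where "v = (\<lambda>j K g. \<alpha> j K + sum g (H j K))"
  have X: "X F = next_states m (\<lambda>j f. v j F f) F (Y s F)" if "F \<in> Pf pos_funs" for F
    using s[of F] that by (auto simp: P_def X_def v_def \<alpha>_def H_def split: prod.splits)
  have \<alpha>H: "\<alpha> j F \<in> pos \<and> H j F \<in> Pf pos \<and> (\<forall>G\<in>below F. Max (H j G) < Min (H j F))"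
    if "F \<in> Pf pos_funs" "j \<in> {1..m}" for F j
    using s[of F] that by (auto simp: P_def \<alpha>_def H_def split: prod.splits)
  have Y: "Y s F = insert (0, \<lambda>_. undefined) (\<Union>G\<in>below F. X G)" for F
    by (simp add: Y_def X_def)
  show thesis
  proof (rule that[of \<alpha> H])
    show "\<forall>j\<in>{1..m}. \<alpha> j \<in> Pf pos_funs \<rightarrow> pos \<and> H j \<in> Pf pos_funs \<rightarrow> Pf pos"
      using \<alpha>H by blast
    show "\<forall>F\<in>Pf pos_funs. \<forall>K\<in>Pf pos_funs. F \<subset> K \<longrightarrow> (\<forall>j\<in>{1..m}. Max (H j F) < Min (H j K))"
      using \<alpha>H by (auto simp: below_def)
    show "\<forall>G \<beta> f. (\<forall>i\<in>pos. G i \<in> Pf pos_funs \<and> G i \<subset> G (Suc i) \<and> f i \<in> G i) \<longrightarrow>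
       (\<forall>j\<in>{1..m}. \<beta> j \<in> Pf pos) \<longrightarrow> (\<forall>j\<in>{1..<m}. block_less (\<beta> j) (\<beta> (Suc j))) \<longrightarrow>
       good m (block_tuple (\<lambda>j K g. \<alpha> j K + sum g (H j K)) m G f \<beta>)"
      unfolding v_def[symmetric]
    proof (intro allI impI)
      fix G \<beta> f
      assume "\<forall>i\<in>pos. G i \<in> Pf pos_funs \<and> G i \<subset> G (Suc i) \<and> f i \<in> G i"
      then have G: "\<And>i. i \<in> pos \<Longrightarrow> G i \<in> Pf pos_funs" "\<And>i. i \<in> pos \<Longrightarrow> G i \<subset> G (Suc i)"
        "\<And>i. i \<in> pos \<Longrightarrow> f i \<in> G i" by auto
      assume \<beta>: "\<forall>j\<in>{1..m}. \<beta> j \<in> Pf pos" and less: "\<forall>j\<in>{1..<m}. block_less (\<beta> j) (\<beta> (Suc j))"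
      have "G i \<subset> G (Suc (i + d))" if "i \<in> pos" for i d
      proof (induction d)
        case 0
        then show ?case using G(2)[OF that] by simp
      next
        case (Suc d)
        also have "G (Suc (i + d)) \<subset> G (Suc (i + Suc d))"
          using G(2)[of "Suc (i + d)"] by (simp add: pos_iff)
        finally show ?case .
      qed
      then have mono: "G i \<subset> G i'" if "i \<in> pos" "i < i'" for i i'
        using that less_iff_Suc_add[of i i'] by auto
      have X_Y: "X (G i) \<subseteq> Y s (G i')" if "i \<in> pos" "i < i'" for i i'
        using G(1)[OF that(1)] mono[OF that] by (auto simp: Y below_def)
      \<comment> \<open>Induction on the largest index: the smallest index of \<open>B\<close> opens
        the block from \<open>x\<close>, and every later one extends the state reached at its
        predecessor in \<open>B\<close>.\<close>
      have block: "(Suc k, x(Suc k := \<Sum>i\<in>B. v (Suc k) (G i) (f i))) \<in> X (G (Max B))"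
        if "k < m" "finite B" "B \<noteq> {}" "B \<subseteq> pos" "\<And>i. i \<in> B \<Longrightarrow> (k, x) \<in> Y s (G i)" for k x B
        using that(2-5)
      proof (induction B rule: finite_linorder_max_induct)
        case (insert b B)
        have b: "b \<in> pos" using insert.prems by blast
        have Max: "Max (insert b B) = b"
          using insert.hyps by (intro Max_eqI) (auto intro: less_imp_le)
        show ?case
        proof (cases "B = {}")
          case True
          have "(Suc k, x(Suc k := v (Suc k) (G b) (f b))) \<in> X (G b)"
            unfolding X[OF G(1)[OF b]] using insert.prems G(3)[OF b] \<open>k < m\<close>
            by (intro next_statesI) auto
          moreover have "(\<Sum>i\<in>insert b B. v (Suc k) (G i) (f i)) = v (Suc k) (G b) (f b)"
            using True by simp
          ultimately show ?thesis by (simp only: Max)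
        next
          case False
          let ?z = "x(Suc k := \<Sum>i\<in>B. v (Suc k) (G i) (f i))"
          have "(Suc k, ?z) \<in> X (G (Max B))" using insert False by blast
          moreover have "Max B \<in> B" using False insert.hyps by simp
          then have "Max B \<in> pos" "Max B < b" using insert by auto
          ultimately have "(Suc k, ?z) \<in> Y s (G b)" using X_Y by blast
          then have "(Suc k, ?z(Suc k := ?z (Suc k) + v (Suc k) (G b) (f b))) \<in> X (G b)"
            unfolding X[OF G(1)[OF b]]
            by (rule next_statesI(1)) (use G(3)[OF b] in simp_all)
          moreover have "b \<notin> B" using insert.hyps by blast
          then have "(\<Sum>i\<in>insert b B. v (Suc k) (G i) (f i)) = ?z (Suc k) + v (Suc k) (G b) (f b)"
            using insert.hyps by simp
          ultimately show ?thesis by (simp only: Max fun_upd_upd)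
        qed
      qed simp
      have "(k, block_tuple v k G f \<beta>) \<in> Y s (G i)"
        if "k \<le> m" "i \<in> pos" "k \<ge> 1 \<longrightarrow> Max (\<beta> k) < i" for k i
        using that
      proof (induction k arbitrary: i)
        case 0
        then show ?case by (simp add: Y block_tuple_def restrict_def)
      next
        case (Suc k)
        have B: "finite (\<beta> (Suc k))" "\<beta> (Suc k) \<noteq> {}" "\<beta> (Suc k) \<subseteq> pos"
          using \<beta> Suc.prems(1) by (auto simp: Pf_def)
        have "(k, block_tuple v k G f \<beta>) \<in> Y s (G i')" if i': "i' \<in> \<beta> (Suc k)" for i'
        proof (rule Suc.IH)
          show "k \<ge> 1 \<longrightarrow> Max (\<beta> k) < i'"
          proof
            assume "k \<ge> 1"
            then have "Max (\<beta> k) < Min (\<beta> (Suc k))"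
              using less Suc.prems(1) by (auto simp: block_less_def)
            then show "Max (\<beta> k) < i'" using Min_le[OF B(1) i'] by linarith
          qed
        qed (use Suc.prems i' B in auto)
        then have "(Suc k, block_tuple v (Suc k) G f \<beta>) \<in> X (G (Max (\<beta> (Suc k))))"
          unfolding block_tuple_Suc using Suc.prems(1) B by (intro block) auto
        moreover have "Max (\<beta> (Suc k)) \<in> pos" using B Max_in by blast
        ultimately show ?case using X_Y Suc.prems(3) by auto
      qed
      \<comment> \<open>One index past the last block, the finished tuple is among the states
        available.\<close>
      then have "(m, block_tuple v m G f \<beta>) \<in> Y s (G (Suc (Max (\<beta> m))))"
        by (simp add: pos_iff)
      moreover have "G (Suc (Max (\<beta> m))) \<in> Pf pos_funs" by (simp add: G pos_iff)
      ultimately show "good m (block_tuple v m G f \<beta>)" using Y_good s by blast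
    qed
  qed
qed

lemma block_maps_of_tensor:
  assumes "m \<ge> 1" and A: "A \<subseteq> pos_tuples m"
    and p: "\<And>j. j \<in> {1..m} \<Longrightarrow> p j \<in> J_ultrafilters" "\<And>j. j \<in> {1..m} \<Longrightarrow> uf_plus (p j) (p j) = p j"
    and tensor: "A \<in> tensor p m"
  obtains \<alpha> H where "\<forall>j\<in>{1..m}. \<alpha> j \<in> Pf pos_funs \<rightarrow> pos \<and> H j \<in> Pf pos_funs \<rightarrow> Pf pos"
    "\<forall>F\<in>Pf pos_funs. \<forall>K\<in>Pf pos_funs. F \<subset> K \<longrightarrow> (\<forall>j\<in>{1..m}. Max (H j F) < Min (H j K))"
    "\<forall>G \<beta> f. (\<forall>i\<in>pos. G i \<in> Pf pos_funs \<and> G i \<subset> G (Suc i) \<and> f i \<in> G i) \<longrightarrow>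
       (\<forall>j\<in>{1..m}. \<beta> j \<in> Pf pos) \<longrightarrow> (\<forall>j\<in>{1..<m}. block_less (\<beta> j) (\<beta> (Suc j))) \<longrightarrow>
       block_tuple (\<lambda>j K g. \<alpha> j K + sum g (H j K)) m G f \<beta> \<in> A"
proof -
  obtain L where L: "L m = A" "\<forall>k<m. \<forall>x\<in>pos_tuples k.
      x \<in> L k \<longleftrightarrow> {y \<in> pos. x(Suc k := y) \<in> L (Suc k)} \<in> p (Suc k)"
    "A \<in> tensor p m \<longleftrightarrow> (\<lambda>_. undefined) \<in> L 0"
    by (rule tensor_sections[OF assms(1,2), where p = p])
  have pb: "p j \<in> beta_pos" if "j \<in> {1..m}" for j using p(1)[OF that] by (simp add: J_ultrafilters_def)
  \<comment> \<open>\<open>E j x\<close> collects the admissible values of coordinate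
    \<open>j\<close>. It does not depend on \<open>x j\<close>, so it stays fixed while block
    \<open>j\<close> grows. In \<open>good\<close>, membership in \<open>L j\<close> lets the next
    block open and the shift condition lets the current one grow; the state 0 has no current
    block.\<close>
  define E where "E = (\<lambda>j x. {y \<in> pos. x(j := y) \<in> L j})"
  define good where "good = (\<lambda>j x. x \<in> pos_tuples j \<and> x \<in> L j \<and> (j \<ge> 1 \<longrightarrow> shift (x j) (E j x) \<in> p j))"
  have E_upd: "E j (x(j := z)) = E j x" for j x z by (simp add: E_def)
  have good_0: "good 0 (\<lambda>_. undefined)" using L(3) tensor by (simp add: good_def pos_tuples_def)
  have open_block: "{z \<in> pos. good (Suc j) (x(Suc j := z))} \<in> p (Suc j)" if j: "j < m" "good j x" for j x
  proof -
    have j': "Suc j \<in> {1..m}" using j by simp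
    have "E (Suc j) x \<in> p (Suc j)" using j L(2) by (auto simp: good_def E_def)
    from idempotent_star[OF pb[OF j'] p(2)[OF j'] this] show ?thesis
      by (rule beta_pos_mono[OF pb[OF j']])
        (use j pos_tuples_upd(1) in \<open>auto simp: good_def E_upd\<close>, auto simp: E_def)
  qed
  have extend_block: "{z \<in> pos. good j (x(j := x j + z))} \<in> p j" if j: "j \<in> {1..m}" "good j x" for j x
  proof -
    have x: "x j \<in> pos" "shift (x j) (E j x) \<in> p j"
      using j by (auto simp: good_def pos_tuples_def)
    from idempotent_star_shift[OF pb[OF j(1)] p(2)[OF j(1)] this] show ?thesis
      by (rule beta_pos_mono[OF pb[OF j(1)]])
        (use j pos_tuples_upd(2) in \<open>auto simp: good_def E_upd\<close>, auto simp: E_def)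
  qed
  obtain \<alpha> H where "\<forall>j\<in>{1..m}. \<alpha> j \<in> Pf pos_funs \<rightarrow> pos \<and> H j \<in> Pf pos_funs \<rightarrow> Pf pos"
    "\<forall>F\<in>Pf pos_funs. \<forall>K\<in>Pf pos_funs. F \<subset> K \<longrightarrow> (\<forall>j\<in>{1..m}. Max (H j F) < Min (H j K))"
    "\<forall>G \<beta> f. (\<forall>i\<in>pos. G i \<in> Pf pos_funs \<and> G i \<subset> G (Suc i) \<and> f i \<in> G i) \<longrightarrow>
       (\<forall>j\<in>{1..m}. \<beta> j \<in> Pf pos) \<longrightarrow> (\<forall>j\<in>{1..<m}. block_less (\<beta> j) (\<beta> (Suc j))) \<longrightarrow>
       good m (block_tuple (\<lambda>j K g. \<alpha> j K + sum g (H j K)) m G f \<beta>)"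
    by (rule block_maps_exist[OF \<open>m \<ge> 1\<close> p(1) good_0 open_block extend_block])
  then show thesis using that[of \<alpha> H] L(1) by (simp add: good_def)
qed

theorem corollary1p26:
  fixes m :: nat and A :: "(nat \<Rightarrow> nat) set"
  assumes "m \<in> pos" and "A \<subseteq> pos_tuples m"
  shows
    "(\<exists>(\<alpha> :: nat \<Rightarrow> (nat \<Rightarrow> nat) set \<Rightarrow> nat) (H :: nat \<Rightarrow> (nat \<Rightarrow> nat) set \<Rightarrow> nat set).
        (\<forall>j \<in> {1..m}. \<alpha> j \<in> Pf pos_funs \<rightarrow> pos \<and> H j \<in> Pf pos_funs \<rightarrow> Pf pos) \<and>
        (\<forall>F \<in> Pf pos_funs. \<forall>G \<in> Pf pos_funs. F \<subset> G \<longrightarrow>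
           (\<forall>j \<in> {1..m}. Max (H j F) < Min (H j G))) \<and>
        (\<forall>G :: nat \<Rightarrow> (nat \<Rightarrow> nat) set.
           (\<forall>i \<in> pos. G i \<in> Pf pos_funs) \<and> (\<forall>i \<in> pos. G i \<subset> G (i + 1)) \<longrightarrow>
           (\<forall>(\<beta> :: nat \<Rightarrow> nat set) (f :: nat \<Rightarrow> nat \<Rightarrow> nat).
              (\<forall>j \<in> {1..m}. \<beta> j \<in> Pf pos) \<and>
              (\<forall>j \<in> {1..<m}. block_less (\<beta> j) (\<beta> (j + 1))) \<and>
              (\<forall>i \<in> pos. f i \<in> G i) \<longrightarrow>
              (\<lambda>j\<in>{1..m}. \<Sum>i\<in>\<beta> j. (\<alpha> j (G i) + (\<Sum>t\<in>H j (G i). f i t))) \<in> A)))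
     \<longleftrightarrow>
     (\<exists>p :: nat \<Rightarrow> nat set set.
        (\<forall>j \<in> {1..m}. p j \<in> J_ultrafilters \<and> uf_plus (p j) (p j) = p j) \<and>
        A \<in> tensor p m)"
proof -
  have "m \<ge> 1" using assms(1) by (simp add: pos_def)
  show ?thesis
  proof (intro iffI; elim exE conjE)
    fix \<alpha> :: "nat \<Rightarrow> (nat \<Rightarrow> nat) set \<Rightarrow> nat" and H :: "nat \<Rightarrow> (nat \<Rightarrow> nat) set \<Rightarrow> nat set"
    assume \<alpha>H: "\<forall>j \<in> {1..m}. \<alpha> j \<in> Pf pos_funs \<rightarrow> pos \<and> H j \<in> Pf pos_funs \<rightarrow> Pf pos"
      and in_A: "\<forall>G :: nat \<Rightarrow> (nat \<Rightarrow> nat) set.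
           (\<forall>i \<in> pos. G i \<in> Pf pos_funs) \<and> (\<forall>i \<in> pos. G i \<subset> G (i + 1)) \<longrightarrow>
           (\<forall>(\<beta> :: nat \<Rightarrow> nat set) (f :: nat \<Rightarrow> nat \<Rightarrow> nat).
              (\<forall>j \<in> {1..m}. \<beta> j \<in> Pf pos) \<and>
              (\<forall>j \<in> {1..<m}. block_less (\<beta> j) (\<beta> (j + 1))) \<and>
              (\<forall>i \<in> pos. f i \<in> G i) \<longrightarrow>
              (\<lambda>j\<in>{1..m}. \<Sum>i\<in>\<beta> j. (\<alpha> j (G i) + (\<Sum>t\<in>H j (G i). f i t))) \<in> A)"
    define v where "v = (\<lambda>j K f. \<alpha> j K + sum f (H j K))"
    have "\<exists>q. q \<in> J_ultrafilters \<and> uf_plus q q = q \<and> (\<forall>F\<in>Pf pos_funs. chain_sums (v j) F \<in> q)"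
      if "j \<in> {1..m}" for j
    proof -
      have "\<alpha> j \<in> Pf pos_funs \<rightarrow> pos" "H j \<in> Pf pos_funs \<rightarrow> Pf pos" using \<alpha>H that by blast+
      then obtain q where "q \<in> J_ultrafilters" "uf_plus q q = q" "\<forall>F\<in>Pf pos_funs. chain_sums (v j) F \<in> q"
        by (rule idempotent_of_chain_sums[of _ _ "v j"]) (simp add: v_def)
      then show ?thesis by blast
    qed
    then obtain p where p: "\<And>j. j \<in> {1..m} \<Longrightarrow> p j \<in> J_ultrafilters \<and> uf_plus (p j) (p j) = p j \<and>
        (\<forall>F\<in>Pf pos_funs. chain_sums (v j) F \<in> p j)"
      by metis
    have "A \<in> tensor p m"
    proof (rule tensor_of_block_tuples[OF \<open>m \<ge> 1\<close> assms(2), where v = v])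
      show "p j \<in> beta_pos" if "j \<in> {1..m}" for j
        using p[OF that] by (simp add: J_ultrafilters_def)
      show "chain_sums (v j) F \<in> p j" if "j \<in> {1..m}" "F \<in> Pf pos_funs" for j F
        using p[OF that(1)] that(2) by blast
      show "v j K f \<in> pos" if "j \<in> {1..m}" "K \<in> Pf pos_funs" for j K f
        using \<alpha>H that by (auto simp: v_def pos_iff Pi_iff)
      show "block_tuple v m G f \<beta> \<in> A"
        if "\<And>i. i \<in> pos \<Longrightarrow> G i \<in> Pf pos_funs" "\<And>i. i \<in> pos \<Longrightarrow> G i \<subset> G (Suc i)"
          "\<And>j. j \<in> {1..m} \<Longrightarrow> \<beta> j \<in> Pf pos" "\<And>j. j \<in> {1..<m} \<Longrightarrow> block_less (\<beta> j) (\<beta> (Suc j))"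
          "\<And>i. i \<in> pos \<Longrightarrow> f i \<in> G i" for G f \<beta>
        using in_A[rule_format, of G \<beta> f] that unfolding block_tuple_def v_def by simp
    qed
    then show "\<exists>p. (\<forall>j \<in> {1..m}. p j \<in> J_ultrafilters \<and> uf_plus (p j) (p j) = p j) \<and> A \<in> tensor p m"
      using p by blast
  next
    fix p assume p: "\<forall>j \<in> {1..m}. p j \<in> J_ultrafilters \<and> uf_plus (p j) (p j) = p j"
      and tensor: "A \<in> tensor p m"
    obtain \<alpha> H where "\<forall>j\<in>{1..m}. \<alpha> j \<in> Pf pos_funs \<rightarrow> pos \<and> H j \<in> Pf pos_funs \<rightarrow> Pf pos"
      "\<forall>F\<in>Pf pos_funs. \<forall>K\<in>Pf pos_funs. F \<subset> K \<longrightarrow> (\<forall>j\<in>{1..m}. Max (H j F) < Min (H j K))"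
      "\<forall>G \<beta> f. (\<forall>i\<in>pos. G i \<in> Pf pos_funs \<and> G i \<subset> G (Suc i) \<and> f i \<in> G i) \<longrightarrow>
         (\<forall>j\<in>{1..m}. \<beta> j \<in> Pf pos) \<longrightarrow> (\<forall>j\<in>{1..<m}. block_less (\<beta> j) (\<beta> (Suc j))) \<longrightarrow>
         block_tuple (\<lambda>j K g. \<alpha> j K + sum g (H j K)) m G f \<beta> \<in> A"
      by (rule block_maps_of_tensor[OF \<open>m \<ge> 1\<close> assms(2) _ _ tensor]) (use p in auto)
    then show "(\<exists>(\<alpha> :: nat \<Rightarrow> (nat \<Rightarrow> nat) set \<Rightarrow> nat) (H :: nat \<Rightarrow> (nat \<Rightarrow> nat) set \<Rightarrow> nat set).
        (\<forall>j \<in> {1..m}. \<alpha> j \<in> Pf pos_funs \<rightarrow> pos \<and> H j \<in> Pf pos_funs \<rightarrow> Pf pos) \<and>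
        (\<forall>F \<in> Pf pos_funs. \<forall>G \<in> Pf pos_funs. F \<subset> G \<longrightarrow>
           (\<forall>j \<in> {1..m}. Max (H j F) < Min (H j G))) \<and>
        (\<forall>G :: nat \<Rightarrow> (nat \<Rightarrow> nat) set.
           (\<forall>i \<in> pos. G i \<in> Pf pos_funs) \<and> (\<forall>i \<in> pos. G i \<subset> G (i + 1)) \<longrightarrow>
           (\<forall>(\<beta> :: nat \<Rightarrow> nat set) (f :: nat \<Rightarrow> nat \<Rightarrow> nat).
              (\<forall>j \<in> {1..m}. \<beta> j \<in> Pf pos) \<and>
              (\<forall>j \<in> {1..<m}. block_less (\<beta> j) (\<beta> (j + 1))) \<and>
              (\<forall>i \<in> pos. f i \<in> G i) \<longrightarrow>
              (\<lambda>j\<in>{1..m}. \<Sum>i\<in>\<beta> j. (\<alpha> j (G i) + (\<Sum>t\<in>H j (G i). f i t))) \<in> A)))"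
      unfolding block_tuple_def Suc_eq_plus1 by (intro exI[of _ \<alpha>] exI[of _ H] conjI) simp_all
  qed
qed

end
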